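(* Let $\epsilon>0$, let $\mathbf{C}\in\overline{\mathbb{R}}_+^{n_1\times\dots\times n_{\mathcal{T}}}$, and consider the entropy-regularized problem $$\text{(R)}\qquad \begin{aligned}\min_{\mathbf{M}\in\mathbb{R}_+^{n_1\times\dots\times n_{\mathcal{T}}}}\ & \langle\mathbf{C},\mathbf{M}\rangle+\epsilon D(\mathbf{M})\\ \text{s.t. } & P_t(\mathbf{M})=\mu_t\ \text{ for } t\in\tilde V_=,\qquad P_t(\mathbf{M})\le d_t\ \text{ for } t\in\tilde V_\le,\\ & P_{t_1,t_2}(\mathbf{M})=R^{(t_1,t_2)}\ \text{ for } (t_1,t_2)\in\tilde E.\end{aligned}$$ Assume that there is a feasible solution $\mathbf{M}$ of (R) for which $\mathbf{M}_{i_1\dots i_{\mathcal{T}}}>0$ if and only if $\mathbf{C}_{i_1\dots i_{\mathcal{T}}}<\infty$, $(\mu_t)_{i_t}>0$ for all $t\in\tilde V_=$, $(d_t)_{i_t}>0$ for all $t\in\tilde V_\le$, and $R^{(t_1,t_2)}_{i_{t_1}i_{t_2}}>0$ for all $(t_1,t_2)\in\tilde E$. Let $\mathbf{K}=\exp(-\mathbf{C}/\epsilon)$ and $$\mathbf{U}_{i_1\dots i_{\mathcal{T}}}=\Big(\prod_{t\in\tilde V_=\cup\tilde V_\le}(u_t)_{i_t}\Big)\Big(\prod_{(t_1,t_2)\in\tilde E}U^{(t_1,t_2)}_{i_{t_1}i_{t_2}}\Big).$$ Then the iterative scheme $$\begin{aligned}U^{(t_1,t_2)}&\leftarrow U^{(t_1,t_2)}\odot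 R^{(t_1,t_2)}\,./\,P_{t_1,t_2}(\mathbf{K}\odot\mathbf{U}), && \text{for } (t_1,t_2)\in\tilde E,\\ u_t&\leftarrow u_t\odot\mu_t\,./\,P_t(\mathbf{K}\odot\mathbf{U}), && \text{for } t\in\tilde V_=,\\ u_t&\leftarrow\min\big(u_t\odot d_t\,./\,P_t(\mathbf{K}\odot\mathbf{U}),\ \mathbf{1}\big), && \text{for } t\in\tilde V_\le,\end{aligned}$$ converges linearly, and in the limit point the optimal solution of (R) is given by $\mathbf{M}=\mathbf{K}\odot\mathbf{U}$.
   Context: $\mathcal{T}\ge 2$ and $n_1,\dots,n_{\mathcal{T}}$ are positive integers; $\mathbb{R}_+$ is the set of nonnegative reals and $\overline{\mathbb{R}}_+=\mathbb{R}_+\cup\{\infty\}$, with conventions $0\cdot\infty=0$ and $\exp(-\infty)=0$. $\tilde V_=$ and $\tilde V_\le$ are disjoint subsets of $\{1,\dots,\mathcal{T}\}$ and $\tilde E$ is a set of pairs $(t_1,t_2)$ of distinct elements of $\{1,\dots,\mathcal{T}\}$. The data are $\mu_t,d_t\in\mathbb{R}_+^{n_t}$ and $R^{(t_1,t_2)}\in\mathbb{R}_+^{n_{t_1}\times n_{t_2}}$. $P_t(\mathbf{M})\in\mathbb{R}^{n_t}$ is the vector obtained by summing $\mathbf{M}_{i_1\dots i_{\mathcal{T}}}$ over all indices except $i_t$; $P_{t_1,t_2}(\mathbf{M})$ is the matrix indexed by $(i_{t_1},i_{t_2})$ obtained by summing over all other indices. $\langle\cdot,\cdot\rangle$ is the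 sum of entrywise products; $\odot$, $./$, $\min(\cdot,\cdot)$, $\exp$ are elementwise product, division, minimum and exponential; $\mathbf{1}$ is the all-ones vector; inequalities are elementwise. The entropy term is $$D(\mathbf{M})=\sum_{i_1,\dots,i_{\mathcal{T}}}\big(\mathbf{M}_{i_1\dots i_{\mathcal{T}}}\log(\mathbf{M}_{i_1\dots i_{\mathcal{T}}})-\mathbf{M}_{i_1\dots i_{\mathcal{T}}}+1\big),\qquad 0\log 0=0.$$ The scheme acts on $u_t\in\mathbb{R}_+^{n_t}$ ($t\in\tilde V_=\cup\tilde V_\le$) and $U^{(t_1,t_2)}\in\mathbb{R}_+^{n_{t_1}\times n_{t_2}}$ ($(t_1,t_2)\in\tilde E$). The updates are performed cyclically, one block at a time, each using the most recent values of all other blocks in $\mathbf{U}$ (block coordinate ascent in the dual of (R)). Let $I$ be the set of tuples $(i_1,\dots,i_{\mathcal{T}})$ satisfying all the positivity/finiteness conditions in the assumption. Entries $(u_t)_{i_t}$ and $U^{(t_1,t_2)}_{i_{t_1}i_{t_2}}$ whose indices do not occur in any tuple of $I$ are set (and kept) equal to $0$; all other entries are initialized at strictly positive values. *)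

theory Defs
  imports "HOL-Analysis.Analysis"
begin

text \<open>
  Modes are \<open>1, ..., modes P\<close> and mode \<open>t\<close> has indices \<open>1, ..., dims P t\<close>. Vectors, matrices and
  tensors are total functions of which only the values at these indices matter.
\<close>

type_synonym tuple = "nat \<Rightarrow> nat"
type_synonym tensor = "tuple \<Rightarrow> real"
type_synonym edge = "nat \<times> nat"

record mot_problem =
  modes :: nat                                        \<comment> \<open>the number of modes, \<open>\<T>\<close>\<close>
  dims :: "nat \<Rightarrow> nat"                                \<comment> \<open>\<open>n\<close>\<close>
  eq_modes :: "nat set"                               \<comment> \<open>\<open>V\<^sub>=\<close>\<close>
  le_modes :: "nat set"                               \<comment> \<open>\<open>V\<^sub>\<le>\<close>\<close>
  edges :: "edge set"                                 \<comment> \<open>\<open>E\<close>\<close>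
  eq_marg :: "nat \<Rightarrow> nat \<Rightarrow> real"                      \<comment> \<open>\<open>\<mu>\<close>\<close>
  le_marg :: "nat \<Rightarrow> nat \<Rightarrow> real"                      \<comment> \<open>\<open>d\<close>\<close>
  edge_marg :: "edge \<Rightarrow> nat \<Rightarrow> nat \<Rightarrow> real"            \<comment> \<open>\<open>R\<close>\<close>
  cost :: "tuple \<Rightarrow> ereal"                            \<comment> \<open>\<open>C\<close>\<close>
  reg :: real                                         \<comment> \<open>\<open>\<epsilon>\<close>\<close>

definition tuples :: "mot_problem \<Rightarrow> tuple set" where
  "tuples P = (\<Pi>\<^sub>E t\<in>{1..modes P}. {1..dims P t})"

definition valid_data :: "mot_problem \<Rightarrow> bool" where
  "valid_data P \<longleftrightarrow>
     2 \<le> modes P \<and> (\<forall>t\<in>{1..modes P}. 1 \<le> dims P t) \<and>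
     eq_modes P \<subseteq> {1..modes P} \<and> le_modes P \<subseteq> {1..modes P} \<and> eq_modes P \<inter> le_modes P = {} \<and>
     edges P \<subseteq> {1..modes P} \<times> {1..modes P} \<and> (\<forall>(s, t)\<in>edges P. s \<noteq> t) \<and>
     (\<forall>t\<in>eq_modes P. \<forall>j\<in>{1..dims P t}. 0 \<le> eq_marg P t j) \<and>
     (\<forall>t\<in>le_modes P. \<forall>j\<in>{1..dims P t}. 0 \<le> le_marg P t j) \<and>
     (\<forall>(s, t)\<in>edges P. \<forall>j\<in>{1..dims P s}. \<forall>k\<in>{1..dims P t}. 0 \<le> edge_marg P (s, t) j k)"

definition marginal :: "mot_problem \<Rightarrow> nat \<Rightarrow> tensor \<Rightarrow> nat \<Rightarrow> real" where
  "marginal P t M j = (\<Sum>i\<in>{i \<in> tuples P. i t = j}. M i)"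

definition bimarginal :: "mot_problem \<Rightarrow> edge \<Rightarrow> tensor \<Rightarrow> nat \<Rightarrow> nat \<Rightarrow> real" where
  "bimarginal P e M j k = (\<Sum>i\<in>{i \<in> tuples P. i (fst e) = j \<and> i (snd e) = k}. M i)"

text \<open>The conventions \<open>0 log 0 = 0\<close> and \<open>0 \<cdot> \<infinity> = 0\<close> hold for \<^const>\<open>ln\<close> and on \<^typ>\<open>ereal\<close>.\<close>

definition entropy_term :: "mot_problem \<Rightarrow> tensor \<Rightarrow> real" where
  "entropy_term P M = (\<Sum>i\<in>tuples P. M i * ln (M i) - M i + 1)"

definition objective :: "mot_problem \<Rightarrow> tensor \<Rightarrow> ereal" where
  "objective P M = (\<Sum>i\<in>tuples P. cost P i * ereal (M i)) + ereal (reg P * entropy_term P M)"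

definition feasible :: "mot_problem \<Rightarrow> tensor \<Rightarrow> bool" where
  "feasible P M \<longleftrightarrow>
     (\<forall>i\<in>tuples P. 0 \<le> M i) \<and>
     (\<forall>t\<in>eq_modes P. \<forall>j\<in>{1..dims P t}. marginal P t M j = eq_marg P t j) \<and>
     (\<forall>t\<in>le_modes P. \<forall>j\<in>{1..dims P t}. marginal P t M j \<le> le_marg P t j) \<and>
     (\<forall>(s, t)\<in>edges P. \<forall>j\<in>{1..dims P s}. \<forall>k\<in>{1..dims P t}.
        bimarginal P (s, t) M j k = edge_marg P (s, t) j k)"

definition optimal :: "mot_problem \<Rightarrow> tensor \<Rightarrow> bool" where
  "optimal P M \<longleftrightarrow> feasible P M \<and> (\<forall>M'. feasible P M' \<longrightarrow> objective P M \<le> objective P M')"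

definition support_tuples :: "mot_problem \<Rightarrow> tuple set" where
  "support_tuples P = {i \<in> tuples P.
     cost P i < \<infinity> \<and>
     (\<forall>t\<in>eq_modes P. 0 < eq_marg P t (i t)) \<and>
     (\<forall>t\<in>le_modes P. 0 < le_marg P t (i t)) \<and>
     (\<forall>(s, t)\<in>edges P. 0 < edge_marg P (s, t) (i s) (i t))}"

definition kernel :: "mot_problem \<Rightarrow> tensor" where
  "kernel P i = (if cost P i = \<infinity> then 0 else exp (- real_of_ereal (cost P i) / reg P))"

text \<open>A scaling is the pair of the vectors \<open>u\<^sub>t\<close> and the matrices \<open>U\<^bsup>(s, t)\<^esup>\<close>.\<close>

type_synonym scaling = "(nat \<Rightarrow> nat \<Rightarrow> real) \<times> (edge \<Rightarrow> nat \<Rightarrow> nat \<Rightarrow> real)"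

fun scaling_tensor :: "mot_problem \<Rightarrow> scaling \<Rightarrow> tensor" where
  "scaling_tensor P (u, U) i =
     (\<Prod>t\<in>eq_modes P \<union> le_modes P. u t (i t)) * (\<Prod>(s, t)\<in>edges P. U (s, t) (i s) (i t))"

definition scaled_kernel :: "mot_problem \<Rightarrow> scaling \<Rightarrow> tensor" where
  "scaled_kernel P x i = kernel P i * scaling_tensor P x i"

datatype block = Node nat | Edge edge

definition blocks :: "mot_problem \<Rightarrow> block set" where
  "blocks P = Node ` (eq_modes P \<union> le_modes P) \<union> Edge ` edges P"

text \<open>
  An entry equal to \<open>0\<close> stays \<open>0\<close> under the updates, also when the denominator vanishes,
  because \<open>0 / 0 = 0\<close>.
\<close>

fun update :: "mot_problem \<Rightarrow> block \<Rightarrow> scaling \<Rightarrow> scaling" where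
  "update P (Edge e) (u, U) =
     (u, U(e := \<lambda>j k. U e j k * edge_marg P e j k / bimarginal P e (scaled_kernel P (u, U)) j k))"
| "update P (Node t) (u, U) =
     (u(t := \<lambda>j. if t \<in> eq_modes P
                 then u t j * eq_marg P t j / marginal P t (scaled_kernel P (u, U)) j
                 else min (u t j * le_marg P t j / marginal P t (scaled_kernel P (u, U)) j) 1),
      U)"

text \<open>
  The list \<open>bs\<close> is the order in which the blocks are visited in each cycle, and one step updates a
  single block. Without any blocks (no constraints) the scheme is stationary.
\<close>

primrec scheme :: "mot_problem \<Rightarrow> block list \<Rightarrow> scaling \<Rightarrow> nat \<Rightarrow> scaling" where
  "scheme P bs x 0 = x"
| "scheme P bs x (Suc m) =
     (if bs = [] then scheme P bs x m
      else update P (bs ! (m mod length bs)) (scheme P bs x m))"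

fun initial_scaling :: "mot_problem \<Rightarrow> scaling \<Rightarrow> bool" where
  "initial_scaling P (u, U) \<longleftrightarrow>
     (\<forall>t\<in>eq_modes P \<union> le_modes P. \<forall>j\<in>{1..dims P t}.
        if \<exists>i\<in>support_tuples P. i t = j then 0 < u t j else u t j = 0) \<and>
     (\<forall>(s, t)\<in>edges P. \<forall>j\<in>{1..dims P s}. \<forall>k\<in>{1..dims P t}.
        if \<exists>i\<in>support_tuples P. i s = j \<and> i t = k then 0 < U (s, t) j k else U (s, t) j k = 0)"

text \<open>The \<open>\<ell>\<^sub>1\<close> distance over all entries of all blocks.\<close>

fun scaling_dist :: "mot_problem \<Rightarrow> scaling \<Rightarrow> scaling \<Rightarrow> real" where
  "scaling_dist P (u, U) (v, V) =
     (\<Sum>t\<in>eq_modes P \<union> le_modes P. \<Sum>j\<in>{1..dims P t}. \<bar>u t j - v t j\<bar>) +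
     (\<Sum>(s, t)\<in>edges P. \<Sum>j\<in>{1..dims P s}. \<Sum>k\<in>{1..dims P t}. \<bar>U (s, t) j k - V (s, t) j k\<bar>)"

text \<open>
  Linear convergence is understood in the root sense; as all norms on a finite-dimensional space
  are equivalent, this does not depend on the choice of the distance.
\<close>

definition converges_linearly :: "mot_problem \<Rightarrow> (nat \<Rightarrow> scaling) \<Rightarrow> scaling \<Rightarrow> bool" where
  "converges_linearly P X x \<longleftrightarrow>
     (\<exists>c \<rho>. 0 < \<rho> \<and> \<rho> < 1 \<and> (\<forall>m. scaling_dist P (X m) x \<le> c * \<rho> ^ m))"

end

theory Submission
  imports Defs
begin

text \<open>
  In the variables \<open>y = ln u\<close> (one coordinate for each positive entry of a block) the scheme is exact
  block minimisation of the convex dual function \<open>F y = \<Sum>\<^sub>i K\<^sub>i exp ((A y)\<^sub>i) - b \<bullet> y\<close> subject to \<open>y \<le> 0\<close> on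
  the inequality coordinates. The strictly positive feasible tensor makes \<open>F\<close> coercive in \<open>A y\<close>, though not
  in \<open>y\<close> itself, so each step decreases \<open>F\<close> by at least a constant times its squared length.

  Linear convergence follows from an error bound in the style of Luo and Tseng: the gap \<open>F y - inf F\<close> is
  eventually at most a constant times the squared length of the last cycle. If not, pass to a subsequence
  along which the set of zero coordinates of \<open>y\<close> is constant. Preimages under \<open>A\<close> that have the signs
  of \<open>y\<close> and are bounded by \<open>A y\<close> then converge to a dual optimum \<open>w\<close> with the same zeros, relative to which
  the gap is quadratic in the residual. A Karush-Kuhn-Tucker point of the dual gives the primal optimum by
  Gibbs' inequality.
\<close>

subsection \<open>Linear systems and estimates\<close>

text \<open>Each support tuple has exactly one index in every block. With two equality blocks, a
  constant can therefore be added to one and subtracted from the other without changing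
  \<open>A y\<close> or \<open>F\<close>, and the dual solutions are unbounded. Estimates for the
  iterates have to go through \<open>A y\<close>; convergence of \<open>y\<close> itself comes last,
  by summing step lengths.

  The second obstacle is complementarity. A coordinate may approach 0 through negative values, where
  its gradient must become small, or sit at 0, where its gradient may stay negative. The preimages
  must not blur this distinction: because they stay 0 where \<open>y\<close> is 0, in each
  coordinate either \<open>y\<close> and \<open>w\<close> both vanish or the gradient of
  \<open>w\<close> vanishes and that of \<open>y\<close> is small. The resulting constant does not
  depend on \<open>w\<close>, so an uncontrolled subsequential limit is good enough as a reference
  point.

  The length of a cycle is a suitable residual because a block is exactly stationary right after its
  update and loses this only through later steps, whose squared lengths are paid for by the decrease
  of \<open>F\<close>.\<close>

lemma finite_uniform_bound:
  fixes f :: "'a \<Rightarrow> 'b \<Rightarrow> real"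
  assumes "finite A" and "\<And>a. a \<in> A \<Longrightarrow> \<exists>R. \<forall>n. f a n \<le> R"
  shows "\<exists>R\<ge>0. \<forall>a\<in>A. \<forall>n. f a n \<le> R"
proof -
  obtain R where R: "\<And>a n. a \<in> A \<Longrightarrow> f a n \<le> R a"
    using assms(2) by metis
  have "f a n \<le> (\<Sum>a\<in>A. \<bar>R a\<bar>)" if "a \<in> A" for a n
    using R[OF that, of n] member_le_sum[of a A "\<lambda>a. \<bar>R a\<bar>"] that assms(1) by force
  then show ?thesis
    by (intro exI[of _ "\<Sum>a\<in>A. \<bar>R a\<bar>"]) (auto intro: sum_nonneg)
qed

lemma finite_coordinates_convergent_subseq:
  fixes f :: "nat \<Rightarrow> 'c \<Rightarrow> real"
  assumes "finite J" and "\<And>c. c \<in> J \<Longrightarrow> \<exists>B. \<forall>n. \<bar>f n c\<bar> \<le> B"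
  shows "\<exists>r l. strict_mono (r :: nat \<Rightarrow> nat) \<and> (\<forall>c\<in>J. (\<lambda>n. f (r n) c) \<longlonglongrightarrow> l c)"
  using assms
proof (induction J)
  case empty
  then show ?case by (auto intro: strict_mono_id)
next
  case (insert d J)
  then obtain r l where r: "strict_mono r" "\<And>c. c \<in> J \<Longrightarrow> (\<lambda>n. f (r n) c) \<longlonglongrightarrow> l c"
    using insert.IH insert.prems by (meson insertI2)
  obtain B where B: "\<And>n. \<bar>f n d\<bar> \<le> B"
    using insert.prems by blast
  have "bounded (range (\<lambda>n. f (r n) d))"
    using B by (auto simp: bounded_iff)
  then obtain v s where s: "strict_mono s" "((\<lambda>n. f (r n) d) \<circ> s) \<longlonglongrightarrow> v"
    using bounded_imp_convergent_subsequence by blast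
  have "(\<lambda>n. f ((r \<circ> s) n) c) \<longlonglongrightarrow> (l(d := v)) c" if "c \<in> insert d J" for c
    using that s r(2)[THEN LIMSEQ_subseq_LIMSEQ, OF _ s(1)] insert.hyps(2)
    by (auto simp: o_def)
  moreover have "strict_mono (r \<circ> s)"
    using r(1) s(1) by (rule strict_mono_o)
  ultimately show ?case by blast
qed

text \<open>The entry \<open>i\<close> of the product \<open>A y\<close>. Index sets are plain sets
  rather than types because the coordinates depend on the problem.\<close>

definition lin :: "'c set \<Rightarrow> ('i \<Rightarrow> 'c \<Rightarrow> real) \<Rightarrow> ('c \<Rightarrow> real) \<Rightarrow> 'i \<Rightarrow> real" where
  "lin J a y i = (\<Sum>c\<in>J. a i c * y c)"

lemma lin_add: "lin J a (\<lambda>c. y c + z c) i = lin J a y i + lin J a z i"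
  by (simp add: lin_def algebra_simps sum.distrib)

lemma lin_diff: "lin J a (\<lambda>c. y c - z c) i = lin J a y i - lin J a z i"
  by (simp add: lin_def algebra_simps sum_subtractf)

lemma lin_scale: "lin J a (\<lambda>c. t * y c) i = t * lin J a y i"
  by (simp add: lin_def sum_distrib_left algebra_simps)

lemma lin_tendsto:
  "(\<And>c. c \<in> J \<Longrightarrow> (\<lambda>n. f n c) \<longlonglongrightarrow> l c) \<Longrightarrow> (\<lambda>n. lin J a (f n) i) \<longlonglongrightarrow> lin J a l i"
  unfolding lin_def by (intro tendsto_sum tendsto_mult tendsto_const)

text \<open>Adjointness of a matrix and its transpose. For the incidence matrix it trades a pairing
  of tensors for a pairing of marginals with \<open>w\<close>.\<close>

lemma sum_lin_swap:
  fixes a :: "'i \<Rightarrow> 'c \<Rightarrow> real"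
  shows
  "(\<Sum>i\<in>I. v i * lin J a w i) = (\<Sum>c\<in>J. (\<Sum>i\<in>I. a i c * v i) * w c)"
proof -
  have "(\<Sum>i\<in>I. v i * lin J a w i) = (\<Sum>i\<in>I. \<Sum>c\<in>J. a i c * v i * w c)"
    by (simp add: lin_def sum_distrib_left algebra_simps)
  also have "\<dots> = (\<Sum>c\<in>J. \<Sum>i\<in>I. a i c * v i * w c)"
    by (rule sum.swap)
  finally show ?thesis
    by (simp add: sum_distrib_right)
qed

text \<open>Compactness: if no constant worked, counterexamples for the constants \<open>n\<close>,
  scaled to total absolute value 1, would have a limit of total 1 that is supported on
  \<open>T\<close> and annihilated by the matrix, against independence.\<close>

lemma independent_columns_bound:
  fixes a :: "'i \<Rightarrow> 'c \<Rightarrow> real"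
  assumes "finite J" "T \<subseteq> J"
    and indep: "\<And>w. \<lbrakk>\<And>c. c \<in> J - T \<Longrightarrow> w c = 0; \<And>i. i \<in> I \<Longrightarrow> lin J a w i = 0\<rbrakk>
                  \<Longrightarrow> \<forall>c\<in>J. w c = 0"
    and fI: "finite I"
  shows "\<exists>C\<ge>0. \<forall>y. (\<forall>c\<in>J - T. y c = 0) \<longrightarrow> (\<forall>c\<in>J. \<bar>y c\<bar> \<le> C * (\<Sum>i\<in>I. \<bar>lin J a y i\<bar>))"
proof (rule ccontr)
  assume "\<not> ?thesis"
  then have "\<forall>n::nat. \<exists>y. (\<forall>c\<in>J - T. y c = 0) \<and>
      (\<exists>c\<in>J. \<bar>y c\<bar> > real n * (\<Sum>i\<in>I. \<bar>lin J a y i\<bar>))"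
    by (metis not_le of_nat_0_le_iff)
  then obtain y where y0: "\<And>n c. c \<in> J - T \<Longrightarrow> y n c = 0"
    and y1: "\<And>n. \<exists>c\<in>J. \<bar>y n c\<bar> > real n * (\<Sum>i\<in>I. \<bar>lin J a (y n) i\<bar>)"
    by metis
  define s where "s n = (\<Sum>c\<in>J. \<bar>y n c\<bar>)" for n
  have s: "s n > real n * (\<Sum>i\<in>I. \<bar>lin J a (y n) i\<bar>)" "s n > 0" for n
  proof -
    obtain c where c: "c \<in> J" "\<bar>y n c\<bar> > real n * (\<Sum>i\<in>I. \<bar>lin J a (y n) i\<bar>)"
      using y1 by blast
    have "\<bar>y n c\<bar> \<le> s n"
      unfolding s_def using c(1) assms(1) by (intro member_le_sum) auto
    then show "s n > real n * (\<Sum>i\<in>I. \<bar>lin J a (y n) i\<bar>)"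
      using c by simp
    moreover have "real n * (\<Sum>i\<in>I. \<bar>lin J a (y n) i\<bar>) \<ge> 0"
      by (simp add: sum_nonneg)
    ultimately show "s n > 0" by linarith
  qed
  define w where "w n c = (1 / s n) * y n c" for n c
  have w_sum: "(\<Sum>c\<in>J. \<bar>w n c\<bar>) = 1" for n
    using s(2)[of n] by (simp add: w_def abs_mult sum_divide_distrib[symmetric] s_def[symmetric])
  have "\<bar>w n c\<bar> \<le> 1" if "c \<in> J" for n c
    using member_le_sum[of c J "\<lambda>c. \<bar>w n c\<bar>"] that assms(1) w_sum[of n] by simp
  then obtain r l where r: "strict_mono r" "\<And>c. c \<in> J \<Longrightarrow> (\<lambda>n. w (r n) c) \<longlonglongrightarrow> l c"
    using finite_coordinates_convergent_subseq[OF assms(1), of w] by metis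
  have "\<forall>c\<in>J. l c = 0"
  proof (rule indep)
    fix c assume c: "c \<in> J - T"
    then have "(\<lambda>n. w (r n) c) = (\<lambda>_. 0)"
      by (simp add: w_def y0)
    with r(2)[of c] c show "l c = 0"
      by (simp add: LIMSEQ_const_iff)
  next
    fix i assume i: "i \<in> I"
    have "\<bar>lin J a (w n) i\<bar> \<le> inverse (real n)" if "n > 0" for n
    proof -
      have "\<bar>lin J a (y n) i\<bar> \<le> (\<Sum>i\<in>I. \<bar>lin J a (y n) i\<bar>)"
        using fI i by (intro member_le_sum) auto
      then have "real n * \<bar>lin J a (y n) i\<bar> \<le> s n"
        using s(1)[of n] by (smt (verit) mult_left_mono of_nat_0_le_iff)
      moreover have "lin J a (w n) i = lin J a (y n) i / s n"
        unfolding w_def by (simp only: lin_scale) simp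
      ultimately have "real n * \<bar>lin J a (w n) i\<bar> \<le> 1"
        using s(2)[of n] by (simp add: abs_divide)
      then show ?thesis
        using that by (simp add: field_simps)
    qed
    then have "(\<lambda>n. lin J a (w n) i) \<longlonglongrightarrow> 0"
      by (intro Lim_null_comparison[OF _ lim_inverse_n]) (auto intro: eventually_sequentiallyI[of 1])
    then have "(\<lambda>n. lin J a (w (r n)) i) \<longlonglongrightarrow> 0"
      using LIMSEQ_subseq_LIMSEQ[OF _ r(1)] by (force simp: o_def)
    moreover have "(\<lambda>n. lin J a (w (r n)) i) \<longlonglongrightarrow> lin J a l i"
      using r(2) by (rule lin_tendsto)
    ultimately show "lin J a l i = 0"
      by (rule LIMSEQ_unique[symmetric])
  qed
  moreover have "(\<lambda>n. \<Sum>c\<in>J. \<bar>w (r n) c\<bar>) \<longlonglongrightarrow> (\<Sum>c\<in>J. \<bar>l c\<bar>)"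
    using r(2) by (intro tendsto_sum tendsto_rabs)
  ultimately show False
    by (simp add: w_sum LIMSEQ_const_iff)
qed

text \<open>
  Caratheodory's argument: a preimage of minimal support uses linearly independent columns,
  and there are only finitely many sets of columns.
\<close>

lemma conformal_bounded_preimage:
  fixes a :: "'i \<Rightarrow> 'c \<Rightarrow> real"
  assumes fJ: "finite J" and fI: "finite I"
  shows "\<exists>C\<ge>0. \<forall>y. \<exists>y'. (\<forall>i\<in>I. lin J a y' i = lin J a y i) \<and>
           (\<forall>c\<in>J. y' c = 0 \<or> sgn (y' c) = sgn (y c)) \<and>
           (\<forall>c\<in>J. \<bar>y' c\<bar> \<le> C * (\<Sum>i\<in>I. \<bar>lin J a y i\<bar>))"
proof -
  define ind where "ind T \<longleftrightarrow> (\<forall>w. (\<forall>c\<in>J - T. w c = 0) \<longrightarrow> (\<forall>i\<in>I. lin J a w i = 0) \<longrightarrow> (\<forall>c\<in>J. w c = 0))" for T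
  have "\<exists>C\<ge>0. ind T \<longrightarrow> (\<forall>y. (\<forall>c\<in>J - T. y c = 0) \<longrightarrow> (\<forall>c\<in>J. \<bar>y c\<bar> \<le> C * (\<Sum>i\<in>I. \<bar>lin J a y i\<bar>)))"
    if "T \<subseteq> J" for T
  proof (cases "ind T")
    case True
    then show ?thesis
      using independent_columns_bound[OF fJ that _ fI, of a] by (simp add: ind_def)
  qed (auto intro: exI[of _ 0])
  then obtain C where C0: "\<And>T. T \<subseteq> J \<Longrightarrow> C T \<ge> 0"
    and C: "\<And>T y c. \<lbrakk>T \<subseteq> J; ind T; \<forall>c\<in>J - T. y c = 0; c \<in> J\<rbrakk> \<Longrightarrow> \<bar>y c\<bar> \<le> C T * (\<Sum>i\<in>I. \<bar>lin J a y i\<bar>)"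
    by metis
  \<comment> \<open>The sum dominates the constant of every independent set of columns, whichever of
    them a given \<open>y\<close> leads to.\<close>
  define D where "D = (\<Sum>T\<in>Pow J. C T)"
  have D: "C T \<le> D" if "T \<subseteq> J" for T
    unfolding D_def using that fJ C0 by (intro member_le_sum) auto
  have "D \<ge> 0"
    unfolding D_def using C0 by (intro sum_nonneg) auto
  have "\<exists>y'. (\<forall>i\<in>I. lin J a y' i = lin J a y i) \<and>
           (\<forall>c\<in>J. y' c = 0 \<or> sgn (y' c) = sgn (y c)) \<and>
           (\<forall>c\<in>J. \<bar>y' c\<bar> \<le> D * (\<Sum>i\<in>I. \<bar>lin J a y i\<bar>))" for y
  proof -
    define conf where "conf y' \<longleftrightarrow> (\<forall>i\<in>I. lin J a y' i = lin J a y i) \<and>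
           (\<forall>c\<in>J. y' c = 0 \<or> sgn (y' c) = sgn (y c))" for y'
    define supp where "supp y' = {c \<in> J. y' c \<noteq> 0}" for y' :: "'c \<Rightarrow> real"
    have "conf y" by (simp add: conf_def)
    then obtain y' where y': "conf y'" and min: "\<And>z. conf z \<Longrightarrow> card (supp y') \<le> card (supp z)"
      using ex_has_least_nat[of conf y "\<lambda>z. card (supp z)"] by blast
    have "ind (supp y')"
      unfolding ind_def
    proof (intro allI impI, rule ccontr)
      fix w assume w0: "\<forall>c\<in>J - supp y'. w c = 0" and wA: "\<forall>i\<in>I. lin J a w i = 0"
        and nz: "\<not> (\<forall>c\<in>J. w c = 0)"
      define N where "N = {c \<in> J. w c \<noteq> 0}"
      have "finite N" "N \<noteq> {}"
        using nz fJ by (auto simp: N_def)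
      \<comment> \<open>Moving from \<open>y'\<close> along the kernel vector \<open>w\<close>, the
        coordinate with the smallest ratio is the first to reach 0. Stopping there flips no sign and
        shrinks the support.\<close>
      then obtain d where d: "d \<in> N" and dmin: "\<And>c. c \<in> N \<Longrightarrow> \<bar>y' d / w d\<bar> \<le> \<bar>y' c / w c\<bar>"
        using ex_is_arg_min_if_finite[of N "\<lambda>c. \<bar>y' c / w c\<bar>"] by (auto simp: is_arg_min_linorder)
      define t where "t = - (y' d / w d)"
      define z where "z c = y' c + t * w c" for c
      have zc: "z c = 0 \<or> sgn (z c) = sgn (y' c)" if "c \<in> J" for c
      proof (cases "w c = 0")
        case False
        then have "\<bar>t\<bar> \<le> \<bar>y' c\<bar> / \<bar>w c\<bar>"
          using dmin[of c] that by (simp add: N_def t_def)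
        then have "\<bar>t * w c\<bar> \<le> \<bar>y' c\<bar>"
          using False by (simp add: abs_mult field_simps)
        moreover have "y' c + s = 0 \<or> sgn (y' c + s) = sgn (y' c)" if "\<bar>s\<bar> \<le> \<bar>y' c\<bar>" for s
          using that by (auto simp: sgn_if abs_if split: if_splits)
        ultimately show ?thesis
          by (simp add: z_def)
      qed (simp add: z_def)
      have "conf z"
        unfolding conf_def
      proof (intro conjI ballI)
        fix i assume "i \<in> I"
        then show "lin J a z i = lin J a y i"
          using wA y' unfolding z_def by (simp add: lin_add lin_scale conf_def)
      next
        fix c assume "c \<in> J"
        then show "z c = 0 \<or> sgn (z c) = sgn (y c)"
          using zc[of c] y' unfolding conf_def by (auto simp: sgn_0_0)
      qed
      moreover have "card (supp z) < card (supp y')"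
      proof (rule psubset_card_mono)
        show "finite (supp y')"
          using fJ by (simp add: supp_def)
        have "z d = 0"
          using d by (simp add: z_def t_def N_def)
        moreover have "d \<in> supp y'"
          using d w0 by (auto simp: N_def)
        moreover have "supp z \<subseteq> supp y'"
          using zc unfolding supp_def by (fastforce simp: sgn_0_0)
        ultimately show "supp z \<subset> supp y'"
          by (auto simp: supp_def)
      qed
      ultimately show False
        using min[of z] by simp
    qed
    then have "\<bar>y' c\<bar> \<le> D * (\<Sum>i\<in>I. \<bar>lin J a y i\<bar>)" if "c \<in> J" for c
    proof -
      have "\<bar>y' c\<bar> \<le> C (supp y') * (\<Sum>i\<in>I. \<bar>lin J a y' i\<bar>)"
        by (rule C[OF _ \<open>ind (supp y')\<close> _ that]) (auto simp: supp_def)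
      also have "(\<Sum>i\<in>I. \<bar>lin J a y' i\<bar>) = (\<Sum>i\<in>I. \<bar>lin J a y i\<bar>)"
        using y' by (simp add: conf_def)
      also have "C (supp y') * \<dots> \<le> D * \<dots>"
        using D[of "supp y'"] by (intro mult_right_mono sum_nonneg) (auto simp: supp_def)
      finally show ?thesis .
    qed
    then show ?thesis
      using y' unfolding conf_def by blast
  qed
  then show ?thesis
    using \<open>D \<ge> 0\<close> by blast
qed

section \<open>Estimates for the exponential function\<close>

lemma exp_quadratic_lower:
  fixes w R :: real
  assumes "\<bar>w\<bar> \<le> R"
  shows "exp w \<ge> 1 + w + exp (- R) / 2 * w\<^sup>2"
proof -
  obtain t where t: "\<bar>t\<bar> \<le> \<bar>w\<bar>" "exp w = (\<Sum>m<2. w ^ m / fact m) + (exp t / fact 2) * w ^ 2"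
    using Maclaurin_exp_le[of w 2] by blast
  have "exp (- R) \<le> exp t"
    using t(1) assms by simp
  then have "exp (- R) / 2 * w\<^sup>2 \<le> exp t / 2 * w\<^sup>2"
    by (intro mult_right_mono) auto
  then show ?thesis
    using t(2) by (simp add: numeral_2_eq_2)
qed

text \<open>Both bounds come from the mean value theorem, since the derivative lies between
  \<open>exp (- R)\<close> and \<open>exp R\<close> on the interval. They give a Lipschitz gradient
  and strong monotonicity, respectively.\<close>

lemma exp_diff_bounds:
  fixes v w R :: real
  assumes "\<bar>v\<bar> \<le> R" "\<bar>w\<bar> \<le> R"
  shows "\<bar>exp v - exp w\<bar> \<le> exp R * \<bar>v - w\<bar>"
    and "(exp v - exp w) * (v - w) \<ge> exp (- R) * (v - w)\<^sup>2"
proof -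
  have *: "\<bar>exp v - exp w\<bar> \<le> exp R * \<bar>v - w\<bar> \<and> (exp v - exp w) * (v - w) \<ge> exp (- R) * (v - w)\<^sup>2"
    if vw: "w < v" "\<bar>v\<bar> \<le> R" "\<bar>w\<bar> \<le> R" for v w :: real
  proof -
    obtain t where t: "w < t" "t < v" "exp v - exp w = (v - w) * exp t"
      using MVT2[of w v exp exp] vw(1) by (auto intro: DERIV_exp)
    have "exp t \<le> exp R" "exp (- R) \<le> exp t"
      using t vw by auto
    then have "(v - w) * exp t \<le> (v - w) * exp R" "(v - w)\<^sup>2 * exp (- R) \<le> (v - w)\<^sup>2 * exp t"
      using vw by (auto intro!: mult_left_mono)
    moreover have "\<bar>exp v - exp w\<bar> = (v - w) * exp t" "(exp v - exp w) * (v - w) = (v - w)\<^sup>2 * exp t"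
      unfolding t(3) power2_eq_square using vw(1) by simp_all
    ultimately show ?thesis
      by (metis abs_of_pos diff_gt_0_iff_gt mult.commute vw(1))
  qed
  consider "v = w" | "w < v" | "v < w" by linarith
  then have "\<bar>exp v - exp w\<bar> \<le> exp R * \<bar>v - w\<bar> \<and> (exp v - exp w) * (v - w) \<ge> exp (- R) * (v - w)\<^sup>2"
  proof cases
    case 3
    then show ?thesis
      using *[of v w] assms by (simp add: abs_minus_commute power2_commute algebra_simps)
  qed (use *[of w v] assms in auto)
  then show "\<bar>exp v - exp w\<bar> \<le> exp R * \<bar>v - w\<bar>"
    and "(exp v - exp w) * (v - w) \<ge> exp (- R) * (v - w)\<^sup>2" by auto
qed

text \<open>The tangent of \<open>k * exp\<close> at \<open>ln (2 * m / k)\<close> has slope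
  \<open>2 * m\<close>, so \<open>m * z\<close> survives the subtraction of \<open>m * z\<close>.
  For negative \<open>z\<close> positivity of the exponential suffices.\<close>

lemma exp_minus_linear_coercive:
  fixes k m z :: real
  assumes "k > 0" "m > 0"
  shows "m * \<bar>z\<bar> \<le> k * exp z - m * z + 2 * m * \<bar>ln (2 * m / k)\<bar>"
proof -
  have "1 + (z - ln (2 * m / k)) \<le> exp (z - ln (2 * m / k))"
    by (rule exp_ge_add_one_self)
  also have "\<dots> = exp z * k / (2 * m)"
    using assms by (simp add: exp_diff)
  finally have "2 * m * (1 + z - ln (2 * m / k)) \<le> k * exp z"
    using assms by (simp add: field_simps)
  moreover have "2 * m * ln (2 * m / k) \<le> 2 * m * \<bar>ln (2 * m / k)\<bar>"
    using assms by (intro mult_left_mono) auto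
  ultimately have "m * z \<le> k * exp z - m * z + 2 * m * \<bar>ln (2 * m / k)\<bar>"
    using assms(2) unfolding distrib_left right_diff_distrib by linarith
  moreover have "- (m * z) \<le> k * exp z - m * z + 2 * m * \<bar>ln (2 * m / k)\<bar>"
    using assms by simp
  ultimately show ?thesis
    using assms by (auto simp: abs_if)
qed

section \<open>Geometric rates\<close>

lemma geometric_increments_converge:
  fixes f :: "nat \<Rightarrow> real"
  assumes "\<And>n. \<bar>f (Suc n) - f n\<bar> \<le> c * \<sigma> ^ n" "0 < \<sigma>" "\<sigma> < 1"
  shows "\<exists>l. \<forall>n. \<bar>f n - l\<bar> \<le> c / (1 - \<sigma>) * \<sigma> ^ n"
proof -
  have *: "\<bar>f (n + k) - f n\<bar> \<le> c / (1 - \<sigma>) * \<sigma> ^ n" for n k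
  proof -
    have "\<bar>f (n + k) - f n\<bar> \<le> c * \<sigma> ^ n * (1 - \<sigma> ^ k) / (1 - \<sigma>)"
    proof (induction k)
      case (Suc k)
      have "\<bar>f (n + Suc k) - f n\<bar> \<le> c * \<sigma> ^ (n + k) + c * \<sigma> ^ n * (1 - \<sigma> ^ k) / (1 - \<sigma>)"
        using Suc assms(1)[of "n + k"] by simp
      also have "\<dots> = c * \<sigma> ^ n * (1 - \<sigma> ^ Suc k) / (1 - \<sigma>)"
        using assms(3) by (simp add: field_simps power_add)
      finally show ?case .
    qed simp
    \<comment> \<open>The sign needed here comes from the hypothesis at \<open>n\<close>:
      \<open>c * \<sigma> ^ n\<close> bounds an absolute value.\<close>
    also have "c * \<sigma> ^ n * (1 - \<sigma> ^ k) / (1 - \<sigma>) \<le> c * \<sigma> ^ n * 1 / (1 - \<sigma>)"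
      using assms(1)[of n] assms(2,3) by (intro divide_right_mono mult_left_mono) auto
    finally show ?thesis by simp
  qed
  have "Cauchy f"
  proof (rule CauchyI')
    fix e :: real assume "e > 0"
    have "(\<lambda>n. c / (1 - \<sigma>) * \<sigma> ^ n) \<longlonglongrightarrow> c / (1 - \<sigma>) * 0"
      using assms by (intro tendsto_mult tendsto_const LIMSEQ_power_zero) auto
    then have "eventually (\<lambda>n. c / (1 - \<sigma>) * \<sigma> ^ n < e) sequentially"
      using \<open>e > 0\<close> by (intro order_tendstoD) auto
    then obtain N where "\<And>n. n \<ge> N \<Longrightarrow> c / (1 - \<sigma>) * \<sigma> ^ n < e"
      by (auto simp: eventually_sequentially)
    then have "dist (f m) (f n) < e" if "m \<ge> N" "m < n" for m n
      using *[of m "n - m"] that by (force simp: dist_real_def abs_minus_commute)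
    then show "\<exists>M. \<forall>m\<ge>M. \<forall>n>m. dist (f m) (f n) < e" by blast
  qed
  then obtain l where l: "f \<longlonglongrightarrow> l"
    using Cauchy_convergent_iff convergent_def by blast
  have "\<bar>f n - l\<bar> \<le> c / (1 - \<sigma>) * \<sigma> ^ n" for n
  proof -
    have "(\<lambda>k. \<bar>f (k + n) - f n\<bar>) \<longlonglongrightarrow> \<bar>l - f n\<bar>"
      using LIMSEQ_ignore_initial_segment[OF l] by (intro tendsto_intros)
    then have "\<bar>l - f n\<bar> \<le> c / (1 - \<sigma>) * \<sigma> ^ n"
      by (rule tendsto_upperbound) (use *[of n] in \<open>simp_all add: add.commute\<close>)
    then show ?thesis by (simp add: abs_minus_commute)
  qed
  then show ?thesis by blast
qed

text \<open>A contraction by \<open>q\<close> every \<open>L\<close> steps gives the rate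
  \<open>root L q\<close> per step. The factor \<open>c\<close> is chosen so that monotonicity alone
  covers the first \<open>N + L\<close> terms.\<close>

lemma root_linear_decay:
  fixes \<Phi> :: "nat \<Rightarrow> real"
  assumes contr: "\<And>m. m \<ge> N \<Longrightarrow> \<Phi> (m + L) \<le> q * \<Phi> m" and "decseq \<Phi>" and "0 < L" "0 < q" "q < 1"
    and nonneg: "\<And>m. \<Phi> m \<ge> 0"
  shows "\<exists>c \<rho>. 0 < \<rho> \<and> \<rho> < 1 \<and> 0 \<le> c \<and> (\<forall>m. \<Phi> m \<le> c * \<rho> ^ m)"
proof -
  define \<rho> where "\<rho> = root L q"
  have \<rho>: "0 < \<rho>" "\<rho> < 1" "\<rho> ^ L = q"
    using assms by (auto simp: \<rho>_def)
  define c where "c = \<Phi> 0 / \<rho> ^ (N + L)"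
  have "\<Phi> m \<le> c * \<rho> ^ m" for m
  proof (induction m rule: less_induct)
    case (less m)
    show ?case
    proof (cases "m < N + L")
      case True
      have "\<rho> ^ (N + L) \<le> \<rho> ^ m"
        using True \<rho> by (intro power_decreasing) auto
      then have "c * \<rho> ^ (N + L) \<le> c * \<rho> ^ m"
        using nonneg[of 0] \<rho> by (intro mult_left_mono) (auto simp: c_def)
      moreover have "c * \<rho> ^ (N + L) = \<Phi> 0"
        using \<rho> by (simp add: c_def)
      moreover have "\<Phi> m \<le> \<Phi> 0"
        using assms(2) by (simp add: decseqD)
      ultimately show ?thesis by linarith
    next
      case False
      then have "\<Phi> m \<le> q * \<Phi> (m - L)"
        using contr[of "m - L"] by simp
      also have "\<dots> \<le> q * (c * \<rho> ^ (m - L))"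
        using less[of "m - L"] False \<open>0 < L\<close> \<open>0 < q\<close> by (intro mult_left_mono) auto
      also have "\<dots> = c * \<rho> ^ (L + (m - L))"
        using \<rho> by (simp add: power_add)
      finally show ?thesis
        using False by simp
    qed
  qed
  moreover have "c \<ge> 0"
    using nonneg[of 0] \<rho> by (simp add: c_def)
  ultimately show ?thesis
    using \<rho> by blast
qed

subsection \<open>Block coordinate ascent in logarithmic variables\<close>

lemma finite_positive_lower_bound:
  fixes f :: "'a \<Rightarrow> real"
  assumes "finite A" and "\<And>a. a \<in> A \<Longrightarrow> 0 < f a"
  shows "\<exists>\<beta>>0. \<forall>a\<in>A. \<beta> \<le> f a"
proof (cases "A = {}")
  case False
  then show ?thesis
    using assms by (intro exI[of _ "Min (f ` A)"]) auto
qed (auto intro: exI[of _ 1])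

text \<open>Two features of the scheme carry the analysis. A tuple has one index per block, so the
  coordinates of a block act on disjoint sets of tuples and updating them together is an exact
  minimisation (\<open>disjoint_in_block\<close>). The cyclic order enters as a bounded wait for
  every coordinate (\<open>window\<close>). \<open>M0\<close> is the strictly positive feasible
  tensor, and \<open>b\<close> holds the prescribed marginals.\<close>

locale block_dual_ascent =
  fixes I :: "'i set" and J :: "'c set" and a :: "'i \<Rightarrow> 'c \<Rightarrow> real"
    and k M0 :: "'i \<Rightarrow> real" and b :: "'c \<Rightarrow> real" and Q :: "'c set"
    and x :: "nat \<Rightarrow> 'c \<Rightarrow> real" and B :: "nat \<Rightarrow> 'c set" and L :: nat
  assumes fin_I: "finite I" and fin_J: "finite J"
    and a01: "\<lbrakk>i \<in> I; c \<in> J\<rbrakk> \<Longrightarrow> a i c = 0 \<or> a i c = 1"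
    and column: "c \<in> J \<Longrightarrow> \<exists>i\<in>I. a i c = 1"
    and k_pos: "i \<in> I \<Longrightarrow> 0 < k i" and M0_pos: "i \<in> I \<Longrightarrow> 0 < M0 i"
    and b_pos: "c \<in> J \<Longrightarrow> 0 < b c"
    and M0_eq: "\<lbrakk>c \<in> J; c \<notin> Q\<rbrakk> \<Longrightarrow> (\<Sum>i\<in>I. a i c * M0 i) = b c"
    and M0_le: "\<lbrakk>c \<in> J; c \<in> Q\<rbrakk> \<Longrightarrow> (\<Sum>i\<in>I. a i c * M0 i) \<le> b c"
    and disjoint_in_block: "\<lbrakk>i \<in> I; c \<in> J; d \<in> J; c \<in> B m; d \<in> B m; a i c = 1; a i d = 1\<rbrakk> \<Longrightarrow> c = d"
    and start: "\<lbrakk>c \<in> J; c \<in> Q\<rbrakk> \<Longrightarrow> x 0 c \<le> 0"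
    and step: "c \<in> J \<Longrightarrow> x (Suc m) c =
      (if c \<in> B m then
         (let y = x m c + ln (b c / (\<Sum>i\<in>I. a i c * (k i * exp (lin J a (x m) i))))
          in if c \<in> Q then min y 0 else y)
       else x m c)"
    and window: "c \<in> J \<Longrightarrow> \<exists>j<L. c \<in> B (m + j)"
    and L_pos: "0 < L"
begin

text \<open>In logarithmic variables this is the entry of K \<odot> U at a support tuple;
  \<open>col\<close> is the corresponding marginal.\<close>

definition mass :: "('c \<Rightarrow> real) \<Rightarrow> 'i \<Rightarrow> real" where
  "mass y i = k i * exp (lin J a y i)"

definition col :: "('c \<Rightarrow> real) \<Rightarrow> 'c \<Rightarrow> real" where
  "col y c = (\<Sum>i\<in>I. a i c * mass y i)"

definition grad :: "('c \<Rightarrow> real) \<Rightarrow> 'c \<Rightarrow> real" where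
  "grad y c = col y c - b c"

definition F :: "('c \<Rightarrow> real) \<Rightarrow> real" where
  "F y = (\<Sum>i\<in>I. mass y i) - (\<Sum>c\<in>J. b c * y c)"

definition incr :: "nat \<Rightarrow> 'c \<Rightarrow> real" where
  "incr m c = x (Suc m) c - x m c"

definition total_incr :: "nat \<Rightarrow> real" where
  "total_incr m = (\<Sum>c\<in>J. \<bar>incr m c\<bar>)"

text \<open>The error \<open>\<eta>\<close> sits in the gradient alone, while the multiplier
  \<open>g\<close> obeys sign and complementarity exactly. Hence the same \<open>g\<close> remains
  valid as long as \<open>y c\<close> is not changed, however the other coordinates move.\<close>

definition kkt :: "('c \<Rightarrow> real) \<Rightarrow> 'c \<Rightarrow> real \<Rightarrow> bool" where
  "kkt y c \<eta> \<longleftrightarrow> (\<exists>g. (c \<notin> Q \<longrightarrow> g = 0) \<and> (c \<in> Q \<longrightarrow> g \<le> 0 \<and> g * y c = 0) \<and> \<bar>grad y c - g\<bar> \<le> \<eta>)"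

lemma kkt_mono: "kkt y c \<eta> \<Longrightarrow> \<eta> \<le> \<eta>' \<Longrightarrow> kkt y c \<eta>'"
  unfolding kkt_def by (elim exE) (rule exI, auto)

lemma mass_pos: "i \<in> I \<Longrightarrow> 0 < mass y i"
  by (simp add: mass_def k_pos)

lemma col_pos: assumes "c \<in> J" shows "0 < col y c"
proof -
  obtain i where i: "i \<in> I" "a i c = 1"
    using column[OF assms] by blast
  have "0 \<le> a j c * mass y j" if "j \<in> I" for j
    using a01[OF that assms] mass_pos[OF that, of y] by auto
  then show ?thesis
    unfolding col_def using i mass_pos[OF i(1), of y] fin_I by (intro sum_pos2[of I i]) auto
qed

lemma step_col:
  "c \<in> J \<Longrightarrow> x (Suc m) c =
      (if c \<in> B m then
         (let y = x m c + ln (b c / col (x m) c) in if c \<in> Q then min y 0 else y)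
       else x m c)"
  using step by (simp add: col_def mass_def)

lemma nonpos: "\<lbrakk>c \<in> J; c \<in> Q\<rbrakk> \<Longrightarrow> x m c \<le> 0"
  by (induction m) (auto simp: start step_col Let_def)

text \<open>Convexity of \<open>F\<close>: apply 1 + s \<le> exp s in each tuple; the linear part of
  \<open>F\<close> contributes equally to both sides.\<close>

lemma F_gradient_inequality: "(\<Sum>c\<in>J. grad y c * (w c - y c)) \<le> F w - F y"
proof -
  have "mass y i * lin J a (\<lambda>c. w c - y c) i \<le> mass w i - mass y i" if "i \<in> I" for i
  proof -
    have "mass w i = mass y i * exp (lin J a w i - lin J a y i)"
      by (simp add: mass_def exp_diff)
    moreover have "mass y i * (1 + (lin J a w i - lin J a y i)) \<le> mass y i * exp (lin J a w i - lin J a y i)"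
      using mass_pos[OF that, of y] by (intro mult_left_mono) (auto intro: exp_ge_add_one_self)
    ultimately show ?thesis
      by (simp add: lin_diff algebra_simps)
  qed
  then have "(\<Sum>i\<in>I. mass y i * lin J a (\<lambda>c. w c - y c) i) \<le> (\<Sum>i\<in>I. mass w i - mass y i)"
    by (rule sum_mono)
  moreover have "(\<Sum>i\<in>I. mass y i * lin J a (\<lambda>c. w c - y c) i) = (\<Sum>c\<in>J. col y c * (w c - y c))"
    by (simp add: sum_lin_swap col_def)
  moreover have "(\<Sum>c\<in>J. grad y c * (w c - y c)) = (\<Sum>c\<in>J. col y c * (w c - y c)) - (\<Sum>c\<in>J. b c * w c) + (\<Sum>c\<in>J. b c * y c)"
    by (simp add: grad_def algebra_simps sum.distrib sum_subtractf)
  ultimately show ?thesis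
    by (simp add: F_def sum_subtractf)
qed

section \<open>A single block update\<close>

lemma incr_outside_block: "\<lbrakk>c \<in> J; c \<notin> B m\<rbrakk> \<Longrightarrow> incr m c = 0"
  by (simp add: incr_def step_col)

lemma lin_incr: "lin J a (x (Suc m)) i = lin J a (x m) i + lin J a (incr m) i"
  unfolding incr_def lin_diff by simp

lemma sum_over_block:
  assumes "i \<in> I" "c \<in> J" "c \<in> B m" "a i c = 1" and "\<And>d. d \<in> J \<Longrightarrow> d \<notin> B m \<Longrightarrow> h d = 0"
  shows "(\<Sum>d\<in>J. a i d * h d) = h c"
proof -
  have "a i d * h d = 0" if "d \<in> J - {c}" for d
    using a01[of i d] assms that disjoint_in_block[of i c d m] by auto
  then have "(\<Sum>d\<in>J - {c}. a i d * h d) = 0"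
    by (intro sum.neutral) blast
  then show ?thesis
    using assms(2,4) fin_J by (simp add: sum.remove)
qed

lemma lin_incr_block:
  "\<lbrakk>i \<in> I; c \<in> J; c \<in> B m; a i c = 1\<rbrakk> \<Longrightarrow> lin J a (incr m) i = incr m c"
  unfolding lin_def by (rule sum_over_block) (auto simp: incr_outside_block)

text \<open>Every tuple counted in \<open>c\<close> meets no other coordinate of the block, so all
  of these tuples are rescaled by the same factor.\<close>

lemma col_after_step:
  assumes "c \<in> J" "c \<in> B m"
  shows "col (x (Suc m)) c = col (x m) c * exp (incr m c)"
proof -
  have "a i c * mass (x (Suc m)) i = a i c * mass (x m) i * exp (incr m c)" if "i \<in> I" for i
    using a01[OF that assms(1)] lin_incr_block[OF that assms]
    by (auto simp: mass_def lin_incr exp_add)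
  then show ?thesis
    unfolding col_def sum_distrib_right by (intro sum.cong) blast+
qed

text \<open>An unclipped update makes the marginal equal to its target, so the multiplier is 0. A
  clipped one stops early, with the coordinate at 0 and the marginal at most its target, so the
  gradient is its own multiplier.\<close>

lemma kkt_after_step:
  assumes "c \<in> J" "c \<in> B m"
  shows "kkt (x (Suc m)) c 0"
proof -
  have pos: "0 < col (x m) c" "0 < b c"
    using col_pos b_pos assms by auto
  define \<theta> where "\<theta> = ln (b c / col (x m) c)"
  have \<theta>: "col (x m) c * exp \<theta> = b c"
    using pos by (simp add: \<theta>_def)
  have x': "x (Suc m) c = (if c \<in> Q then min (x m c + \<theta>) 0 else x m c + \<theta>)"
    using assms by (simp add: step_col \<theta>_def)
  show ?thesis
  proof (cases "c \<in> Q \<and> x m c + \<theta> > 0")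
    case True
    then have "x (Suc m) c = 0"
      using x' by simp
    moreover from this have "exp (incr m c) \<le> exp \<theta>"
      using True by (simp add: incr_def)
    then have "col (x m) c * exp (incr m c) \<le> b c"
      using pos \<theta> by (metis mult_left_mono less_imp_le)
    ultimately show ?thesis
      using True unfolding kkt_def
      by (intro exI[of _ "grad (x (Suc m)) c"]) (simp add: grad_def col_after_step[OF assms])
  next
    case False
    then have "incr m c = \<theta>"
      using x' by (auto simp: incr_def)
    then show ?thesis
      unfolding kkt_def using \<theta> by (intro exI[of _ 0]) (simp add: grad_def col_after_step[OF assms])
  qed
qed

text \<open>The right side is the share of \<open>c\<close> in the decrease of \<open>F\<close>.
  Written through the new marginal, it can be compared with the fixed target \<open>b c\<close>,
  which frees the lower bound from the current iterate. Without clipping this is an equality; with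
  clipping the new marginal is at most the target, and the increment is nonnegative because
  inequality coordinates never exceed 0.\<close>

lemma coordinate_decrease:
  assumes "c \<in> J"
  shows "b c * (exp (- incr m c) - 1 + incr m c) \<le> b c * incr m c - col (x m) c * (exp (incr m c) - 1)"
proof (cases "c \<in> B m")
  case True
  have pos: "0 < col (x m) c" "0 < b c"
    using col_pos b_pos assms by auto
  define \<theta> where "\<theta> = ln (b c / col (x m) c)"
  have \<theta>: "col (x m) c * exp \<theta> = b c"
    using pos by (simp add: \<theta>_def)
  have x': "x (Suc m) c = (if c \<in> Q then min (x m c + \<theta>) 0 else x m c + \<theta>)"
    using assms True by (simp add: step_col \<theta>_def)
  have "(col (x m) c * exp (incr m c)) * (1 - exp (- incr m c)) \<le> b c * (1 - exp (- incr m c))"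
  proof (cases "c \<in> Q \<and> x m c + \<theta> > 0")
    case clipped: True
    then have "incr m c \<le> \<theta>" "incr m c \<ge> 0"
      using x' nonpos[of c m] assms by (auto simp: incr_def)
    moreover from this have "col (x m) c * exp (incr m c) \<le> b c"
      using pos \<theta> by (metis exp_le_cancel_iff mult_left_mono less_imp_le)
    ultimately show ?thesis
      by (intro mult_right_mono) auto
  next
    case False
    then have "incr m c = \<theta>"
      using x' by (auto simp: incr_def)
    then show ?thesis
      using \<theta> by simp
  qed
  moreover have "(col (x m) c * exp (incr m c)) * (1 - exp (- incr m c)) = col (x m) c * (exp (incr m c) - 1)"
    by (simp add: right_diff_distrib mult.assoc flip: exp_add)
  moreover have "b c * (exp (- incr m c) - 1 + incr m c) = b c * incr m c - b c * (1 - exp (- incr m c))"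
    by (simp add: algebra_simps)
  ultimately show ?thesis
    by linarith
qed (simp add: incr_outside_block assms)

text \<open>A tuple meets at most one coordinate that changes, so its relative change
  \<open>exp (lin J a (incr m) i) - 1\<close> is a sum over coordinates, and the decrease of
  \<open>F\<close> splits accordingly.\<close>

lemma F_decrease:
  "(\<Sum>c\<in>J. b c * (exp (- incr m c) - 1 + incr m c)) \<le> F (x m) - F (x (Suc m))"
proof -
  have "mass (x (Suc m)) i - mass (x m) i = (\<Sum>c\<in>J. a i c * mass (x m) i * (exp (incr m c) - 1))"
    if i: "i \<in> I" for i
  proof -
    have "exp (lin J a (incr m) i) - 1 = (\<Sum>c\<in>J. a i c * (exp (incr m c) - 1))"
    proof (cases "\<exists>c\<in>J. c \<in> B m \<and> a i c = 1")
      case True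
      then obtain c where c: "c \<in> J" "c \<in> B m" "a i c = 1" by blast
      show ?thesis
        using sum_over_block[OF i c, of "\<lambda>c. exp (incr m c) - 1"] lin_incr_block[OF i c]
        by (simp add: incr_outside_block)
    next
      case False
      then have "a i c * incr m c = 0 \<and> a i c * (exp (incr m c) - 1) = 0" if "c \<in> J" for c
        using that a01[OF i that] incr_outside_block[OF that] by (cases "c \<in> B m") auto
      then have "(\<Sum>c\<in>J. a i c * incr m c) = 0" "(\<Sum>c\<in>J. a i c * (exp (incr m c) - 1)) = 0"
        by (intro sum.neutral; blast)+
      then show ?thesis
        by (simp add: lin_def)
    qed
    moreover have "mass (x (Suc m)) i - mass (x m) i = mass (x m) i * (exp (lin J a (incr m) i) - 1)"
      by (simp add: mass_def lin_incr exp_add algebra_simps)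
    ultimately show ?thesis
      by (simp add: sum_distrib_left mult.left_commute mult.assoc)
  qed
  then have "(\<Sum>i\<in>I. mass (x (Suc m)) i) - (\<Sum>i\<in>I. mass (x m) i)
      = (\<Sum>i\<in>I. \<Sum>c\<in>J. a i c * mass (x m) i * (exp (incr m c) - 1))"
    by (simp flip: sum_subtractf)
  also have "\<dots> = (\<Sum>c\<in>J. col (x m) c * (exp (incr m c) - 1))"
    unfolding col_def sum_distrib_right by (rule sum.swap)
  finally have "F (x m) - F (x (Suc m)) = (\<Sum>c\<in>J. b c * incr m c - col (x m) c * (exp (incr m c) - 1))"
    by (simp add: F_def incr_def algebra_simps sum_subtractf sum.distrib)
  then show ?thesis
    using coordinate_decrease by (simp add: sum_mono)
qed

section \<open>Descent, coercivity and bounded steps\<close>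

lemma F_decseq: "decseq (\<lambda>m. F (x m))"
proof (rule decseq_SucI)
  fix m
  have "0 \<le> b c * (exp (- incr m c) - 1 + incr m c)" if "c \<in> J" for c
    using b_pos[OF that] exp_ge_add_one_self[of "- incr m c"] by (intro mult_nonneg_nonneg) auto
  then show "F (x (Suc m)) \<le> F (x m)"
    using F_decrease[of m] sum_nonneg[of J "\<lambda>c. b c * (exp (- incr m c) - 1 + incr m c)"] by force
qed

text \<open>The error terms of \<open>exp_minus_linear_coercive\<close> for the slopes
  \<open>M0 i\<close> and factors \<open>k i\<close>, summed over all tuples.\<close>

definition coercivity_const :: real where
  "coercivity_const = (\<Sum>i\<in>I. 2 * M0 i * \<bar>ln (2 * M0 i / k i)\<bar>)"

text \<open>The linear part of \<open>F\<close> may be replaced by the pairing of \<open>M0\<close>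
  with \<open>A y\<close>: the two agree on equality coordinates, and on the others \<le> holds
  because \<open>y\<close> is nonpositive and the marginal of \<open>M0\<close> is at most
  \<open>b\<close>. What remains is one coercive function of \<open>(A y) i\<close> for each
  tuple.\<close>

lemma F_coercive:
  assumes "\<And>c. c \<in> J \<Longrightarrow> c \<in> Q \<Longrightarrow> y c \<le> 0"
  shows "(\<Sum>i\<in>I. M0 i * \<bar>lin J a y i\<bar>) \<le> F y + coercivity_const"
proof -
  have "(\<Sum>i\<in>I. M0 i * \<bar>lin J a y i\<bar>)
      \<le> (\<Sum>i\<in>I. k i * exp (lin J a y i) - M0 i * lin J a y i + 2 * M0 i * \<bar>ln (2 * M0 i / k i)\<bar>)"
    by (intro sum_mono exp_minus_linear_coercive k_pos M0_pos)
  also have "\<dots> = (\<Sum>i\<in>I. mass y i) - (\<Sum>i\<in>I. M0 i * lin J a y i) + coercivity_const"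
    by (simp add: mass_def coercivity_const_def sum.distrib sum_subtractf)
  also have "(\<Sum>i\<in>I. M0 i * lin J a y i) = (\<Sum>c\<in>J. (\<Sum>i\<in>I. a i c * M0 i) * y c)"
    by (rule sum_lin_swap)
  also have "(\<Sum>i\<in>I. mass y i) - (\<Sum>c\<in>J. (\<Sum>i\<in>I. a i c * M0 i) * y c) \<le> F y"
    unfolding F_def
  proof (intro diff_left_mono sum_mono)
    fix c assume c: "c \<in> J"
    show "b c * y c \<le> (\<Sum>i\<in>I. a i c * M0 i) * y c"
      using M0_eq[OF c] M0_le[OF c] assms[OF c] by (cases "c \<in> Q") (auto intro: mult_right_mono_neg)
  qed
  finally show ?thesis by simp
qed

lemma F_lower: "- coercivity_const \<le> F (x m)"
proof -
  have "0 \<le> (\<Sum>i\<in>I. M0 i * \<bar>lin J a (x m) i\<bar>)"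
    by (intro sum_nonneg mult_nonneg_nonneg) (auto intro: less_imp_le M0_pos)
  then show ?thesis
    using F_coercive[of "x m"] nonpos by force
qed

text \<open>The iterates stay in a sublevel set of \<open>F\<close>, on which every entry of
  \<open>A y\<close> is bounded because every \<open>M0 i\<close> is positive.\<close>

lemma lin_bounded: "\<exists>R\<ge>0. \<forall>i\<in>I. \<forall>m. \<bar>lin J a (x m) i\<bar> \<le> R"
proof (rule finite_uniform_bound[OF fin_I])
  fix i assume i: "i \<in> I"
  have "\<bar>lin J a (x m) i\<bar> \<le> (F (x 0) + coercivity_const) / M0 i" for m
  proof -
    have "M0 i * \<bar>lin J a (x m) i\<bar> \<le> (\<Sum>i\<in>I. M0 i * \<bar>lin J a (x m) i\<bar>)"
      using i fin_I by (intro member_le_sum) (auto intro!: mult_nonneg_nonneg less_imp_le[OF M0_pos])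
    also have "\<dots> \<le> F (x m) + coercivity_const"
      by (rule F_coercive) (rule nonpos)
    also have "F (x m) \<le> F (x 0)"
      using decseqD[OF F_decseq, of 0 m] by simp
    finally show ?thesis
      using M0_pos[OF i] by (simp add: field_simps)
  qed
  then show "\<exists>R. \<forall>m. \<bar>lin J a (x m) i\<bar> \<le> R" by blast
qed

text \<open>Although the iterates are not yet known to be bounded, the total decrease of
  \<open>F\<close> is, and \<open>exp (- s) - 1 + s\<close> is coercive in \<open>s\<close>.\<close>

lemma incr_bounded: "\<exists>R\<ge>0. \<forall>c\<in>J. \<forall>m. \<bar>incr m c\<bar> \<le> R"
proof (rule finite_uniform_bound[OF fin_J])
  fix c assume c: "c \<in> J"
  have "\<bar>incr m c\<bar> \<le> (F (x 0) + coercivity_const) / b c + 1 + 2 * \<bar>ln 2\<bar>" for m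
  proof -
    have "b d * (exp (- incr m d) - 1 + incr m d) \<ge> 0" if "d \<in> J" for d
      using b_pos[OF that] exp_ge_add_one_self[of "- incr m d"] by (intro mult_nonneg_nonneg) auto
    then have "b c * (exp (- incr m c) - 1 + incr m c) \<le> (\<Sum>c\<in>J. b c * (exp (- incr m c) - 1 + incr m c))"
      using c fin_J by (intro member_le_sum) auto
    also have "\<dots> \<le> F (x m) - F (x (Suc m))"
      by (rule F_decrease)
    also have "\<dots> \<le> F (x 0) + coercivity_const"
      using decseqD[OF F_decseq, of 0 m] F_lower[of "Suc m"] by simp
    finally have "exp (- incr m c) - 1 + incr m c \<le> (F (x 0) + coercivity_const) / b c"
      using b_pos[OF c] by (simp add: field_simps)
    moreover have "\<bar>incr m c\<bar> \<le> exp (- incr m c) + incr m c + 2 * \<bar>ln 2\<bar>"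
      using exp_minus_linear_coercive[of 1 1 "- incr m c"] by simp
    ultimately show ?thesis by simp
  qed
  then show "\<exists>R. \<forall>m. \<bar>incr m c\<bar> \<le> R" by blast
qed

text \<open>The decrease is of second order in each increment, with a uniform constant because
  increments are bounded. Cauchy-Schwarz passes from the sum of squares to the square of the
  sum.\<close>

lemma sufficient_decrease:
  "\<exists>\<kappa>>0. \<forall>m. \<kappa> * (total_incr m)\<^sup>2 \<le> F (x m) - F (x (Suc m))"
proof -
  obtain R where R: "\<And>c m. c \<in> J \<Longrightarrow> \<bar>incr m c\<bar> \<le> R"
    using incr_bounded by blast
  obtain \<beta> where \<beta>: "\<beta> > 0" "\<And>c. c \<in> J \<Longrightarrow> \<beta> \<le> b c"
    using finite_positive_lower_bound[OF fin_J, of b] b_pos by blast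
  define \<gamma> where "\<gamma> = \<beta> * (exp (- R) / 2)"
  \<comment> \<open>One is added so that division by \<open>n\<close> is sound even when there are
    no coordinates.\<close>
  define n where "n = real (card J) + 1"
  have "\<gamma> / n * (total_incr m)\<^sup>2 \<le> F (x m) - F (x (Suc m))" for m
  proof -
    have "(total_incr m)\<^sup>2 \<le> (\<Sum>c\<in>J. \<bar>incr m c\<bar>\<^sup>2) * card J"
      unfolding total_incr_def by (rule sum_squared_le_sum_of_squares)
    also have "\<dots> \<le> (\<Sum>c\<in>J. (incr m c)\<^sup>2) * n"
      by (auto simp: n_def intro!: mult_left_mono sum_nonneg)
    finally have "\<gamma> / n * (total_incr m)\<^sup>2 \<le> \<gamma> / n * ((\<Sum>c\<in>J. (incr m c)\<^sup>2) * n)"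
      using \<beta>(1) by (intro mult_left_mono) (auto simp: \<gamma>_def n_def)
    also have "\<dots> = \<gamma> * (\<Sum>c\<in>J. (incr m c)\<^sup>2)"
      by (simp add: n_def add_nonneg_eq_0_iff)
    also have "\<dots> = (\<Sum>c\<in>J. \<beta> * (exp (- R) / 2 * (incr m c)\<^sup>2))"
      by (simp add: \<gamma>_def sum_distrib_left mult.assoc)
    also have "\<dots> \<le> (\<Sum>c\<in>J. b c * (exp (- incr m c) - 1 + incr m c))"
    proof (intro sum_mono mult_mono)
      fix c assume c: "c \<in> J"
      show "exp (- R) / 2 * (incr m c)\<^sup>2 \<le> exp (- incr m c) - 1 + incr m c"
        using exp_quadratic_lower[of "- incr m c" R] R[OF c, of m] by simp
    qed (use \<beta> b_pos in \<open>auto intro: less_imp_le\<close>)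
    also have "\<dots> \<le> F (x m) - F (x (Suc m))"
      by (rule F_decrease)
    finally show ?thesis .
  qed
  moreover have "\<gamma> / n > 0"
    using \<beta>(1) by (simp add: \<gamma>_def n_def)
  ultimately show ?thesis by blast
qed

section \<open>Stationarity after a window of steps\<close>

lemma total_incr_nonneg: "0 \<le> total_incr m"
  by (simp add: total_incr_def sum_nonneg)

text \<open>The exponential is Lipschitz on bounded sets only, so the constant rests on the bound
  for \<open>A y\<close>.\<close>

lemma grad_lipschitz:
  "\<exists>\<Lambda>\<ge>0. \<forall>m. \<forall>c\<in>J. \<bar>grad (x (Suc m)) c - grad (x m) c\<bar> \<le> \<Lambda> * total_incr m"
proof -
  obtain R where R: "R \<ge> 0" "\<And>i m. i \<in> I \<Longrightarrow> \<bar>lin J a (x m) i\<bar> \<le> R"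
    using lin_bounded by blast
  have "\<bar>grad (x (Suc m)) c - grad (x m) c\<bar> \<le> (\<Sum>i\<in>I. k i * exp R) * total_incr m"
    if c: "c \<in> J" for m c
  proof -
    have "grad (x (Suc m)) c - grad (x m) c = (\<Sum>i\<in>I. a i c * (mass (x (Suc m)) i - mass (x m) i))"
      by (simp add: grad_def col_def algebra_simps sum_subtractf)
    also have "\<bar>\<dots>\<bar> \<le> (\<Sum>i\<in>I. k i * exp R * total_incr m)"
    proof (rule order_trans[OF sum_abs sum_mono])
      fix i assume i: "i \<in> I"
      have "\<bar>lin J a (incr m) i\<bar> \<le> (\<Sum>c\<in>J. \<bar>a i c * incr m c\<bar>)"
        unfolding lin_def by (rule sum_abs)
      also have "\<dots> \<le> total_incr m"
        unfolding total_incr_def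
      proof (rule sum_mono)
        show "\<bar>a i d * incr m d\<bar> \<le> \<bar>incr m d\<bar>" if "d \<in> J" for d
          using a01[OF i that] by auto
      qed
      finally have lin: "\<bar>lin J a (incr m) i\<bar> \<le> total_incr m" .
      have "\<bar>exp (lin J a (x (Suc m)) i) - exp (lin J a (x m) i)\<bar> \<le> exp R * \<bar>lin J a (incr m) i\<bar>"
        using exp_diff_bounds(1)[OF R(2)[OF i, of "Suc m"] R(2)[OF i, of m]] by (simp add: lin_incr)
      also have "\<dots> \<le> exp R * total_incr m"
        using lin by (intro mult_left_mono) auto
      finally have "k i * \<bar>exp (lin J a (x (Suc m)) i) - exp (lin J a (x m) i)\<bar> \<le> k i * (exp R * total_incr m)"
        using k_pos[OF i] by (intro mult_left_mono) auto
      moreover have "\<bar>mass (x (Suc m)) i - mass (x m) i\<bar> = k i * \<bar>exp (lin J a (x (Suc m)) i) - exp (lin J a (x m) i)\<bar>"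
        using k_pos[OF i] by (simp add: mass_def abs_mult flip: right_diff_distrib)
      moreover have "\<bar>a i c * (mass (x (Suc m)) i - mass (x m) i)\<bar> \<le> \<bar>mass (x (Suc m)) i - mass (x m) i\<bar>"
        using a01[OF i c] by auto
      ultimately show "\<bar>a i c * (mass (x (Suc m)) i - mass (x m) i)\<bar> \<le> k i * exp R * total_incr m"
        by simp
    qed
    finally show ?thesis
      by (simp add: sum_distrib_right)
  qed
  moreover have "(\<Sum>i\<in>I. k i * exp R) \<ge> 0"
    using k_pos by (intro sum_nonneg) (simp add: less_imp_le)
  ultimately show ?thesis by blast
qed

text \<open>The residual of the error bound: it controls the violation of stationarity from above,
  and its square is controlled by the decrease of \<open>F\<close>.\<close>

definition window_incr :: "nat \<Rightarrow> real" where
  "window_incr m = (\<Sum>j<L. total_incr (m + j))"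

lemma window_incr_nonneg: "0 \<le> window_incr m"
  by (simp add: window_incr_def sum_nonneg total_incr_nonneg)

text \<open>Right after its last update a coordinate is exactly stationary. From then on its value
  and multiplier are frozen, and its gradient drifts by at most the Lipschitz constant times the
  later steps.\<close>

lemma kkt_after_window:
  "\<exists>\<Lambda>\<ge>0. \<forall>m. \<forall>c\<in>J. kkt (x (m + L)) c (\<Lambda> * window_incr m)"
proof -
  obtain \<Lambda> where \<Lambda>: "\<Lambda> \<ge> 0" "\<And>m c. c \<in> J \<Longrightarrow> \<bar>grad (x (Suc m)) c - grad (x m) c\<bar> \<le> \<Lambda> * total_incr m"
    using grad_lipschitz by blast
  \<comment> \<open>The first alternative records that \<open>c\<close> has not been visited yet; at
    \<open>n = L\<close> it is excluded by \<open>window\<close>.\<close>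
  have *: "(\<forall>j<n. c \<notin> B (m + j)) \<or> kkt (x (m + n)) c (\<Lambda> * (\<Sum>j<n. total_incr (m + j)))"
    if c: "c \<in> J" for m n c
  proof (induction n)
    case (Suc n)
    show ?case
    proof (cases "c \<in> B (m + n)")
      case True
      then have "kkt (x (m + Suc n)) c 0"
        using kkt_after_step[OF c] by simp
      moreover have "0 \<le> \<Lambda> * (\<Sum>j<Suc n. total_incr (m + j))"
        using \<Lambda>(1) by (intro mult_nonneg_nonneg sum_nonneg total_incr_nonneg)
      ultimately show ?thesis
        using kkt_mono by blast
    next
      case False
      then have eq: "x (m + Suc n) c = x (m + n) c"
        using c by (simp add: step_col)
      show ?thesis
      proof (cases "\<forall>j<n. c \<notin> B (m + j)")
        case True
        with False show ?thesis by (auto simp: less_Suc_eq)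
      next
        case False
        then obtain g where g: "c \<notin> Q \<longrightarrow> g = 0" "c \<in> Q \<longrightarrow> g \<le> 0 \<and> g * x (m + n) c = 0"
            "\<bar>grad (x (m + n)) c - g\<bar> \<le> \<Lambda> * (\<Sum>j<n. total_incr (m + j))"
          using Suc by (auto simp: kkt_def)
        have "\<bar>grad (x (m + Suc n)) c - g\<bar> \<le> \<Lambda> * (\<Sum>j<Suc n. total_incr (m + j))"
          using g(3) \<Lambda>(2)[OF c, of "m + n"] by (simp add: distrib_left)
        then have "kkt (x (m + Suc n)) c (\<Lambda> * (\<Sum>j<Suc n. total_incr (m + j)))"
          unfolding kkt_def eq using g(1,2) by blast
        then show ?thesis ..
      qed
    qed
  qed simp
  then have "kkt (x (m + L)) c (\<Lambda> * window_incr m)" if "c \<in> J" for m c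
    using *[where n = L and m = m, OF that] window[OF that, of m] unfolding window_incr_def by blast
  then show ?thesis
    using \<Lambda>(1) by blast
qed

text \<open>Cauchy-Schwarz over the \<open>L\<close> steps costs the factor \<open>L\<close>; the
  single decreases then telescope.\<close>

lemma window_incr_bound:
  "\<exists>C>0. \<forall>m. (window_incr m)\<^sup>2 \<le> C * (F (x m) - F (x (m + L)))"
proof -
  obtain \<kappa> where \<kappa>: "\<kappa> > 0" "\<And>m. \<kappa> * (total_incr m)\<^sup>2 \<le> F (x m) - F (x (Suc m))"
    using sufficient_decrease by blast
  have "(window_incr m)\<^sup>2 \<le> (real L / \<kappa>) * (F (x m) - F (x (m + L)))" for m
  proof -
    have tel: "\<kappa> * (\<Sum>j<n. (total_incr (m + j))\<^sup>2) \<le> F (x m) - F (x (m + n))" for n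
    proof (induction n)
      case (Suc n)
      then show ?case using \<kappa>(2)[of "m + n"] by (simp add: distrib_left)
    qed simp
    have "(window_incr m)\<^sup>2 \<le> (\<Sum>j<L. (total_incr (m + j))\<^sup>2) * card {..<L}"
      unfolding window_incr_def by (rule sum_squared_le_sum_of_squares)
    then have "(window_incr m)\<^sup>2 \<le> (real L / \<kappa>) * (\<kappa> * (\<Sum>j<L. (total_incr (m + j))\<^sup>2))"
      using \<kappa>(1) by (simp add: mult.commute)
    also have "\<dots> \<le> (real L / \<kappa>) * (F (x m) - F (x (m + L)))"
      using tel[of L] \<kappa>(1) by (intro mult_left_mono) auto
    finally show ?thesis .
  qed
  moreover have "real L / \<kappa> > 0"
    using \<kappa>(1) L_pos by simp
  ultimately show ?thesis by blast
qed

text \<open>An infimum along the iterates only. A limiting KKT point \<open>w\<close> satisfies F w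
  \<le> F_inf by \<open>kkt_minimizes\<close>, which is the direction in which a gap relative to
  \<open>w\<close> bounds the gap relative to \<open>F_inf\<close>.\<close>

definition F_inf :: real where
  "F_inf = (INF m. F (x m))"

lemma F_bdd: "bdd_below (range (\<lambda>m. F (x m)))"
  unfolding bdd_below_def using F_lower by blast

lemma F_inf_le: "F_inf \<le> F (x m)"
  unfolding F_inf_def by (intro cINF_lower F_bdd) auto

lemma F_tendsto: "(\<lambda>m. F (x m)) \<longlonglongrightarrow> F_inf"
  unfolding F_inf_def by (rule LIMSEQ_decseq_INF[OF F_bdd F_decseq])

lemma window_incr_tendsto: "window_incr \<longlonglongrightarrow> 0"
proof -
  obtain C where C: "\<And>m. (window_incr m)\<^sup>2 \<le> C * (F (x m) - F (x (m + L)))"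
    using window_incr_bound by blast
  have "(\<lambda>m. C * (F (x m) - F (x (m + L)))) \<longlonglongrightarrow> C * (F_inf - F_inf)"
    by (intro tendsto_intros F_tendsto LIMSEQ_ignore_initial_segment[OF F_tendsto])
  then have "(\<lambda>m. (window_incr m)\<^sup>2) \<longlonglongrightarrow> 0"
    by (intro Lim_null_comparison[of "\<lambda>m. (window_incr m)\<^sup>2" "\<lambda>m. C * (F (x m) - F (x (m + L)))"])
      (use C in auto)
  then show ?thesis by simp
qed

section \<open>Limits, minimisers and error bounds\<close>

lemma mass_tendsto:
  "(\<And>c. c \<in> J \<Longrightarrow> (\<lambda>n. f n c) \<longlonglongrightarrow> l c) \<Longrightarrow> (\<lambda>n. mass (f n) i) \<longlonglongrightarrow> mass l i"
  unfolding mass_def by (intro tendsto_intros lin_tendsto)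

lemma grad_tendsto:
  "(\<And>c. c \<in> J \<Longrightarrow> (\<lambda>n. f n c) \<longlonglongrightarrow> l c) \<Longrightarrow> (\<lambda>n. grad (f n) c) \<longlonglongrightarrow> grad l c"
  unfolding grad_def col_def by (intro tendsto_intros mass_tendsto)

lemma grad_cong: "(\<And>i. i \<in> I \<Longrightarrow> lin J a y i = lin J a w i) \<Longrightarrow> grad y c = grad w c"
  by (simp add: grad_def col_def mass_def)

text \<open>Sign and complementarity make every feasible direction from \<open>w\<close> nonnegative
  against the gradient; convexity does the rest.\<close>

lemma kkt_minimizes:
  assumes "\<And>c. c \<in> J \<Longrightarrow> kkt w c 0" and "\<And>c. c \<in> J \<Longrightarrow> c \<in> Q \<Longrightarrow> y c \<le> 0"
  shows "F w \<le> F y"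
proof -
  have "0 \<le> grad w c * (y c - w c)" if "c \<in> J" for c
  proof (cases "c \<in> Q")
    case True
    then have "grad w c \<le> 0" "grad w c * w c = 0"
      using assms(1)[OF that] by (auto simp: kkt_def)
    moreover have "0 \<le> grad w c * y c"
      using \<open>grad w c \<le> 0\<close> assms(2)[OF that True] by (rule mult_nonpos_nonpos)
    ultimately show ?thesis
      unfolding right_diff_distrib by linarith
  next
    case False
    then show ?thesis
      using assms(1)[OF that] by (auto simp: kkt_def)
  qed
  then have "0 \<le> (\<Sum>c\<in>J. grad w c * (y c - w c))"
    by (rule sum_nonneg)
  also have "\<dots> \<le> F y - F w"
    by (rule F_gradient_inequality)
  finally show ?thesis by simp
qed

text \<open>\<open>F\<close> is not strongly convex in \<open>y\<close>, but it is so in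
  \<open>A y\<close> on bounded sets. Hence the square on the left measures
  \<open>A (y - w)\<close>.\<close>

lemma mass_strongly_monotone:
  assumes "R \<ge> 0"
  shows "\<exists>\<kappa>>0. \<forall>y w. (\<forall>i\<in>I. \<bar>lin J a y i\<bar> \<le> R \<and> \<bar>lin J a w i\<bar> \<le> R) \<longrightarrow>
    \<kappa> * (\<Sum>i\<in>I. \<bar>lin J a (\<lambda>c. y c - w c) i\<bar>)\<^sup>2
      \<le> (\<Sum>i\<in>I. (mass y i - mass w i) * lin J a (\<lambda>c. y c - w c) i)"
proof -
  obtain \<beta> where \<beta>: "\<beta> > 0" "\<And>i. i \<in> I \<Longrightarrow> \<beta> \<le> k i"
    using finite_positive_lower_bound[OF fin_I, of k] k_pos by blast
  define n where "n = real (card I) + 1"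
  define \<gamma> where "\<gamma> = \<beta> * exp (- R)"
  have "\<gamma> / n * (\<Sum>i\<in>I. \<bar>lin J a (\<lambda>c. y c - w c) i\<bar>)\<^sup>2
      \<le> (\<Sum>i\<in>I. (mass y i - mass w i) * lin J a (\<lambda>c. y c - w c) i)"
    if R: "\<forall>i\<in>I. \<bar>lin J a y i\<bar> \<le> R \<and> \<bar>lin J a w i\<bar> \<le> R" for y w
  proof -
    define d where "d i = lin J a (\<lambda>c. y c - w c) i" for i
    have "(\<Sum>i\<in>I. \<bar>d i\<bar>)\<^sup>2 \<le> (\<Sum>i\<in>I. \<bar>d i\<bar>\<^sup>2) * card I"
      by (rule sum_squared_le_sum_of_squares)
    also have "\<dots> \<le> (\<Sum>i\<in>I. (d i)\<^sup>2) * n"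
      by (auto simp: n_def intro!: mult_left_mono sum_nonneg)
    finally have "\<gamma> / n * (\<Sum>i\<in>I. \<bar>d i\<bar>)\<^sup>2 \<le> \<gamma> / n * ((\<Sum>i\<in>I. (d i)\<^sup>2) * n)"
      using \<beta>(1) by (intro mult_left_mono) (auto simp: \<gamma>_def n_def)
    also have "\<dots> = \<gamma> * (\<Sum>i\<in>I. (d i)\<^sup>2)"
      by (simp add: n_def add_nonneg_eq_0_iff)
    also have "\<dots> = (\<Sum>i\<in>I. \<beta> * (exp (- R) * (d i)\<^sup>2))"
      by (simp add: \<gamma>_def sum_distrib_left mult.assoc)
    also have "\<dots> \<le> (\<Sum>i\<in>I. k i * ((exp (lin J a y i) - exp (lin J a w i)) * d i))"
    proof (rule sum_mono)
      fix i assume i: "i \<in> I"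
      have "exp (- R) * (d i)\<^sup>2 \<le> (exp (lin J a y i) - exp (lin J a w i)) * d i"
        using exp_diff_bounds(2)[of "lin J a y i" R "lin J a w i"] R i by (simp add: d_def lin_diff)
      then show "\<beta> * (exp (- R) * (d i)\<^sup>2) \<le> k i * ((exp (lin J a y i) - exp (lin J a w i)) * d i)"
        by (rule mult_mono[OF \<beta>(2)[OF i]]) (use k_pos[OF i] in auto)
    qed
    also have "\<dots> = (\<Sum>i\<in>I. (mass y i - mass w i) * d i)"
      by (simp add: mass_def algebra_simps)
    finally show ?thesis
      by (simp add: d_def)
  qed
  moreover have "\<gamma> / n > 0"
    using \<beta>(1) by (simp add: \<gamma>_def n_def)
  ultimately show ?thesis by blast
qed

text \<open>
  If the reference point \<open>w\<close> vanishes wherever \<open>y\<close> does and its gradient vanishes elsewhere, then the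
  gap \<open>F y - F w\<close> is a quadratic form in \<open>y - w\<close>, which can be evaluated at a bounded preimage instead.
\<close>

lemma quadratic_error_bound:
  assumes "R \<ge> 0"
  shows "\<exists>C\<ge>0. \<forall>y w \<eta>. (\<forall>i\<in>I. \<bar>lin J a y i\<bar> \<le> R \<and> \<bar>lin J a w i\<bar> \<le> R) \<longrightarrow>
    (\<forall>c\<in>J. (y c = 0 \<and> w c = 0) \<or> (grad w c = 0 \<and> \<bar>grad y c\<bar> \<le> \<eta>)) \<longrightarrow> \<eta> \<ge> 0 \<longrightarrow>
    F y - F w \<le> C * \<eta>\<^sup>2"
proof -
  obtain \<kappa> where \<kappa>: "\<kappa> > 0" "\<And>y w. \<forall>i\<in>I. \<bar>lin J a y i\<bar> \<le> R \<and> \<bar>lin J a w i\<bar> \<le> R \<Longrightarrow>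
    \<kappa> * (\<Sum>i\<in>I. \<bar>lin J a (\<lambda>c. y c - w c) i\<bar>)\<^sup>2
      \<le> (\<Sum>i\<in>I. (mass y i - mass w i) * lin J a (\<lambda>c. y c - w c) i)"
    using mass_strongly_monotone[OF assms] by blast
  obtain D where D: "D \<ge> 0" "\<And>y. \<exists>y'. (\<forall>i\<in>I. lin J a y' i = lin J a y i) \<and>
           (\<forall>c\<in>J. y' c = 0 \<or> sgn (y' c) = sgn (y c)) \<and>
           (\<forall>c\<in>J. \<bar>y' c\<bar> \<le> D * (\<Sum>i\<in>I. \<bar>lin J a y i\<bar>))"
    using conformal_bounded_preimage[OF fin_J fin_I, of a] by blast
  define E where "E = D * real (card J)"
  have "E \<ge> 0"
    using D(1) by (simp add: E_def)
  have "F y - F w \<le> E\<^sup>2 / \<kappa> * \<eta>\<^sup>2"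
    if R: "\<forall>i\<in>I. \<bar>lin J a y i\<bar> \<le> R \<and> \<bar>lin J a w i\<bar> \<le> R"
      and alt: "\<forall>c\<in>J. (y c = 0 \<and> w c = 0) \<or> (grad w c = 0 \<and> \<bar>grad y c\<bar> \<le> \<eta>)" and "\<eta> \<ge> 0" for y w \<eta>
  proof -
    define V where "V = (\<Sum>i\<in>I. \<bar>lin J a (\<lambda>c. y c - w c) i\<bar>)"
    define T where "T = (\<Sum>i\<in>I. (mass y i - mass w i) * lin J a (\<lambda>c. y c - w c) i)"
    have "V \<ge> 0"
      by (simp add: V_def sum_nonneg)
    have grad_diff: "grad y c - grad w c = (\<Sum>i\<in>I. a i c * (mass y i - mass w i))" for c
      by (simp add: grad_def col_def algebra_simps sum_subtractf)
    have "F y - F w \<le> (\<Sum>c\<in>J. grad y c * (y c - w c))"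
      using F_gradient_inequality[of y w] by (simp add: algebra_simps sum_subtractf)
    \<comment> \<open>Subtracting \<open>grad w\<close> changes nothing: in each coordinate it is 0
      or multiplied by 0.\<close>
    also have "\<dots> = (\<Sum>c\<in>J. (grad y c - grad w c) * (y c - w c))"
      by (rule sum.cong) (use alt in auto)
    also have "\<dots> = T"
      unfolding T_def sum_lin_swap grad_diff ..
    finally have gap: "F y - F w \<le> T" .
    \<comment> \<open>\<open>T\<close> depends on the difference only through
      \<open>A (y - w)\<close>, so it may be evaluated at \<open>v\<close>. Being conformal,
      \<open>v\<close> vanishes wherever \<open>y\<close> and \<open>w\<close> do, exactly where the
      gradient of \<open>y\<close> is not controlled.\<close>
    obtain v where v: "\<And>i. i \<in> I \<Longrightarrow> lin J a v i = lin J a (\<lambda>c. y c - w c) i"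
        "\<And>c. c \<in> J \<Longrightarrow> v c = 0 \<or> sgn (v c) = sgn (y c - w c)" "\<And>c. c \<in> J \<Longrightarrow> \<bar>v c\<bar> \<le> D * V"
      using D(2)[of "\<lambda>c. y c - w c"] unfolding V_def by blast
    have "T = (\<Sum>i\<in>I. (mass y i - mass w i) * lin J a v i)"
      unfolding T_def by (rule sum.cong) (simp_all add: v(1))
    also have "\<dots> = (\<Sum>c\<in>J. (grad y c - grad w c) * v c)"
      unfolding sum_lin_swap grad_diff ..
    also have "\<dots> \<le> (\<Sum>c\<in>J. \<eta> * (D * V))"
    proof (rule sum_mono)
      fix c assume c: "c \<in> J"
      show "(grad y c - grad w c) * v c \<le> \<eta> * (D * V)"
      proof (cases "y c = 0 \<and> w c = 0")
        case True
        then show ?thesis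
          using v(2)[OF c] \<open>\<eta> \<ge> 0\<close> D(1) \<open>V \<ge> 0\<close> by (auto simp: sgn_0_0)
      next
        case False
        then have "\<bar>(grad y c - grad w c) * v c\<bar> \<le> \<eta> * (D * V)"
          unfolding abs_mult using alt c v(3)[OF c] \<open>\<eta> \<ge> 0\<close> by (intro mult_mono) auto
        then show ?thesis by simp
      qed
    qed
    finally have upper: "T \<le> E * \<eta> * V"
      by (simp add: E_def algebra_simps)
    have "\<kappa> * V\<^sup>2 \<le> T"
      using \<kappa>(2)[OF R] by (simp add: V_def T_def)
    \<comment> \<open>\<open>T\<close> is at least quadratic and at most linear in \<open>V\<close>;
      this bounds \<open>V\<close> by a multiple of \<open>\<eta>\<close>, and then \<open>T\<close>
      by a multiple of its square.\<close>
    with upper have "(\<kappa> * V) * V \<le> (E * \<eta>) * V"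
      by (simp add: power2_eq_square algebra_simps)
    then have "\<kappa> * V \<le> E * \<eta>"
      using \<open>V \<ge> 0\<close> \<open>E \<ge> 0\<close> \<open>\<eta> \<ge> 0\<close> by (cases "V = 0") (auto simp: mult_le_cancel_right)
    then have "V \<le> E * \<eta> / \<kappa>"
      using \<kappa>(1) by (simp add: field_simps)
    then have "E * \<eta> * V \<le> E * \<eta> * (E * \<eta> / \<kappa>)"
      using \<open>E \<ge> 0\<close> \<open>\<eta> \<ge> 0\<close> by (intro mult_left_mono) auto
    then show ?thesis
      using gap upper by (simp add: power2_eq_square algebra_simps)
  qed
  moreover have "E\<^sup>2 / \<kappa> \<ge> 0"
    using \<kappa>(1) by simp
  ultimately show ?thesis by blast
qed

text \<open>Negation supplies times at which the gap exceeds \<open>n\<close> times the squared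
  residual. The constant in \<open>quadratic_error_bound\<close> is uniform over reference points,
  so whichever limit \<open>w\<close> a subsequence produces, a fixed multiple of the squared
  residual bounds the gap.\<close>

lemma gap_le_window_incr:
  "\<exists>C N. \<forall>m\<ge>N. F (x (m + L)) - F_inf \<le> C * (window_incr m)\<^sup>2"
proof (rule ccontr)
  assume contra: "\<not> ?thesis"
  have "\<exists>m\<ge>n. F (x (m + L)) - F_inf > real n * (window_incr m)\<^sup>2" for n
    using contra by (meson not_le)
  then obtain m where m: "\<And>n. m n \<ge> n" "\<And>n. F (x (m n + L)) - F_inf > real n * (window_incr (m n))\<^sup>2"
    by metis
  obtain R where R: "R \<ge> 0" "\<And>i m. i \<in> I \<Longrightarrow> \<bar>lin J a (x m) i\<bar> \<le> R"
    using lin_bounded by blast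
  obtain \<Lambda> where \<Lambda>: "\<Lambda> \<ge> 0" "\<And>m c. c \<in> J \<Longrightarrow> kkt (x (m + L)) c (\<Lambda> * window_incr m)"
    using kkt_after_window by blast
  obtain C where C: "C \<ge> 0" "\<And>y w \<eta>. \<lbrakk>\<forall>i\<in>I. \<bar>lin J a y i\<bar> \<le> R \<and> \<bar>lin J a w i\<bar> \<le> R;
      \<forall>c\<in>J. (y c = 0 \<and> w c = 0) \<or> (grad w c = 0 \<and> \<bar>grad y c\<bar> \<le> \<eta>); \<eta> \<ge> 0\<rbrakk> \<Longrightarrow>
      F y - F w \<le> C * \<eta>\<^sup>2"
    using quadratic_error_bound[OF R(1)] by metis
  obtain D where D: "D \<ge> 0" "\<And>y. \<exists>y'. (\<forall>i\<in>I. lin J a y' i = lin J a y i) \<and>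
           (\<forall>c\<in>J. y' c = 0 \<or> sgn (y' c) = sgn (y c)) \<and>
           (\<forall>c\<in>J. \<bar>y' c\<bar> \<le> D * (\<Sum>i\<in>I. \<bar>lin J a y i\<bar>))"
    using conformal_bounded_preimage[OF fin_J fin_I, of a] by blast
  define Z where "Z n = {c \<in> J. x (m n + L) c = 0}" for n
  have "finite (Z ` UNIV)"
  proof (rule finite_subset)
    show "Z ` UNIV \<subseteq> Pow J"
      by (auto simp: Z_def)
  qed (use fin_J in simp)
  then obtain n0 where inf: "infinite {n. Z n = Z n0}"
    using pigeonhole_infinite[of UNIV Z] by auto
  obtain p :: "nat \<Rightarrow> nat" where p: "strict_mono p" "\<forall>n. p n \<in> {n. Z n = Z n0}"
    using infinite_enumerate[OF inf] by (elim exE conjE)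
  define y where "y n = x (m (p n) + L)" for n
  define W where "W n = window_incr (m (p n))" for n
  have y_zero: "y n c = 0 \<longleftrightarrow> c \<in> Z n0" if "c \<in> J" for n c
  proof -
    have "Z (p n) = Z n0"
      using p(2) by blast
    then have "c \<in> Z n0 \<longleftrightarrow> c \<in> Z (p n)"
      by blast
    also have "\<dots> \<longleftrightarrow> y n c = 0"
      using that by (simp add: Z_def y_def)
    finally show ?thesis by blast
  qed
  have y_kkt: "kkt (y n) c (\<Lambda> * W n)" if "c \<in> J" for n c
    using \<Lambda>(2)[OF that] by (simp add: y_def W_def)
  have W: "W \<longlonglongrightarrow> 0"
  proof -
    have "filterlim (\<lambda>n. m (p n)) at_top sequentially"
    proof (rule filterlim_at_top_mono[OF filterlim_ident])
      show "\<forall>\<^sub>F n in sequentially. n \<le> m (p n)"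
        using m(1) p(1) by (meson always_eventually le_trans seq_suble)
    qed
    then show ?thesis
      using filterlim_compose[OF window_incr_tendsto] by (simp add: W_def[abs_def])
  qed
  obtain y' where y'_lin: "\<And>n i. i \<in> I \<Longrightarrow> lin J a (y' n) i = lin J a (y n) i"
    and y'_sgn: "\<And>n c. c \<in> J \<Longrightarrow> y' n c = 0 \<or> sgn (y' n c) = sgn (y n c)"
    and y'_bd: "\<And>n c. c \<in> J \<Longrightarrow> \<bar>y' n c\<bar> \<le> D * (\<Sum>i\<in>I. \<bar>lin J a (y n) i\<bar>)"
  proof -
    from D(2) have "\<forall>n. \<exists>y'. (\<forall>i\<in>I. lin J a y' i = lin J a (y n) i) \<and>
           (\<forall>c\<in>J. y' c = 0 \<or> sgn (y' c) = sgn (y n c)) \<and>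
           (\<forall>c\<in>J. \<bar>y' c\<bar> \<le> D * (\<Sum>i\<in>I. \<bar>lin J a (y n) i\<bar>))"
      by blast
    then show thesis
      using that by metis
  qed
  have "\<exists>B. \<forall>n. \<bar>y' n c\<bar> \<le> B" if c: "c \<in> J" for c
  proof -
    have "\<bar>y' n c\<bar> \<le> D * (\<Sum>i\<in>I. R)" for n
    proof -
      have "D * (\<Sum>i\<in>I. \<bar>lin J a (y n) i\<bar>) \<le> D * (\<Sum>i\<in>I. R)"
        using D(1) R(2) by (intro mult_left_mono sum_mono) (auto simp: y_def)
      then show ?thesis
        using y'_bd[OF c, of n] by linarith
    qed
    then show ?thesis by blast
  qed
  then obtain r w where r: "strict_mono r" and w: "\<And>c. c \<in> J \<Longrightarrow> (\<lambda>n. y' (r n) c) \<longlonglongrightarrow> w c"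
    using finite_coordinates_convergent_subseq[OF fin_J, of y'] by metis
  \<comment> \<open>Gradients depend on \<open>A y\<close> alone, so those of the possibly unbounded
    \<open>y\<close> converge together with those of \<open>y'\<close>.\<close>
  have grad_lim: "(\<lambda>n. grad (y (r n)) c) \<longlonglongrightarrow> grad w c" for c
  proof -
    have "grad (y (r n)) c = grad (y' (r n)) c" for n
      by (rule grad_cong) (simp add: y'_lin)
    then show ?thesis
      using grad_tendsto[of "\<lambda>n. y' (r n)" w c] w by simp
  qed
  have \<Lambda>W: "(\<lambda>n. \<Lambda> * W (r n)) \<longlonglongrightarrow> 0"
    using tendsto_mult_right_zero[OF LIMSEQ_subseq_LIMSEQ[OF W r], of \<Lambda>] by (simp add: o_def)
  have w_lin: "\<bar>lin J a w i\<bar> \<le> R" if "i \<in> I" for i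
  proof -
    have "(\<lambda>n. \<bar>lin J a (y' (r n)) i\<bar>) \<longlonglongrightarrow> \<bar>lin J a w i\<bar>"
      using w by (intro tendsto_rabs lin_tendsto)
    then show ?thesis
      by (rule tendsto_upperbound) (simp_all add: y'_lin that R(2) y_def)
  qed
  have w_zero: "w c = 0" if "c \<in> J" "c \<in> Z n0" for c
  proof -
    have "y' n c = 0" for n
      using y'_sgn[OF that(1), of n] y_zero[OF that(1), of n] that(2) by (auto simp: sgn_0_0)
    then show ?thesis
      using w[OF that(1)] by (simp add: LIMSEQ_const_iff)
  qed
  \<comment> \<open>At a nonzero inequality coordinate complementarity forces the multiplier to be
    0, as it is on equality coordinates. The KKT error then bounds the gradient itself.\<close>
  have grad_small: "\<bar>grad (y n) c\<bar> \<le> \<Lambda> * W n" if "c \<in> J" "c \<notin> Z n0 \<or> c \<notin> Q" for n c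
    using y_kkt[OF that(1), of n] y_zero[OF that(1), of n] that(2) by (auto simp: kkt_def)
  have grad_w: "grad w c = 0" if "c \<in> J" "c \<notin> Z n0 \<or> c \<notin> Q" for c
  proof -
    have "(\<lambda>n. grad (y (r n)) c) \<longlonglongrightarrow> 0"
      by (rule Lim_null_comparison[OF _ \<Lambda>W]) (simp add: grad_small[OF that])
    then show ?thesis
      using LIMSEQ_unique[OF grad_lim] by blast
  qed
  have grad_w_le: "grad w c \<le> 0" if "c \<in> J" "c \<in> Q" for c
  proof (rule LIMSEQ_le[OF grad_lim \<Lambda>W])
    have "grad (y n) c \<le> \<Lambda> * W n" for n
      using y_kkt[OF that(1), of n] that(2) by (auto simp: kkt_def)
    then show "\<exists>N. \<forall>n\<ge>N. grad (y (r n)) c \<le> \<Lambda> * W (r n)" by blast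
  qed
  have "kkt w c 0" if "c \<in> J" for c
    unfolding kkt_def using grad_w[OF that] grad_w_le[OF that] w_zero[OF that]
    by (intro exI[of _ "grad w c"]) auto
  then have "F w \<le> F (x j)" for j
    by (rule kkt_minimizes) (auto intro: nonpos)
  then have F_w: "F w \<le> F_inf"
    unfolding F_inf_def by (intro cINF_greatest) auto
  \<comment> \<open>From this index on, the factor \<open>p (r n)\<close> of the negated bound is at
    least the constant of the error bound.\<close>
  obtain n :: nat where n: "C * \<Lambda>\<^sup>2 \<le> real n"
    using real_arch_simple by blast
  have "F (y (r n)) - F w \<le> C * (\<Lambda> * W (r n))\<^sup>2"
  proof (rule C(2))
    show "\<forall>i\<in>I. \<bar>lin J a (y (r n)) i\<bar> \<le> R \<and> \<bar>lin J a w i\<bar> \<le> R"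
      using R(2) w_lin by (simp add: y_def)
    show "\<forall>c\<in>J. (y (r n) c = 0 \<and> w c = 0) \<or> (grad w c = 0 \<and> \<bar>grad (y (r n)) c\<bar> \<le> \<Lambda> * W (r n))"
      using y_zero w_zero grad_w grad_small by blast
    show "0 \<le> \<Lambda> * W (r n)"
      using \<Lambda>(1) by (simp add: W_def window_incr_nonneg)
  qed
  also have "\<dots> = (C * \<Lambda>\<^sup>2) * (W (r n))\<^sup>2"
    by (simp add: power_mult_distrib)
  also have "\<dots> \<le> real (p (r n)) * (W (r n))\<^sup>2"
  proof (rule mult_right_mono)
    have "n \<le> p (r n)"
      using seq_suble[OF p(1), of "r n"] seq_suble[OF r, of n] by linarith
    then show "C * \<Lambda>\<^sup>2 \<le> real (p (r n))"
      using n by simp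
  qed simp
  also have "\<dots> < F (y (r n)) - F_inf"
    using m(2)[of "p (r n)"] by (simp add: y_def W_def)
  finally show False
    using F_w by simp
qed

section \<open>Linear rates\<close>

lemma F_gap_decay: "\<exists>c \<rho>. 0 < \<rho> \<and> \<rho> < 1 \<and> 0 \<le> c \<and> (\<forall>m. F (x m) - F_inf \<le> c * \<rho> ^ m)"
proof -
  obtain C N where C: "\<And>m. m \<ge> N \<Longrightarrow> F (x (m + L)) - F_inf \<le> C * (window_incr m)\<^sup>2"
    using gap_le_window_incr by blast
  obtain D where D: "D > 0" "\<And>m. (window_incr m)\<^sup>2 \<le> D * (F (x m) - F (x (m + L)))"
    using window_incr_bound by blast
  \<comment> \<open>The error bound and the decrease combine to \<Phi> (m + L) \<le> q * (\<Phi> m -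
    \<Phi> (m + L)), whence the ratio \<open>q / (1 + q)\<close>. The absolute value and the added 1
    make \<open>q\<close> positive.\<close>
  define q where "q = \<bar>C\<bar> * D + 1"
  have q: "q \<ge> 1"
    using D(1) by (simp add: q_def)
  define \<Phi> where "\<Phi> m = F (x m) - F_inf" for m
  have \<Phi>_dec: "decseq \<Phi>"
    using F_decseq by (auto simp: \<Phi>_def decseq_def)
  have "\<Phi> (m + L) \<le> q / (1 + q) * \<Phi> m" if "m \<ge> N" for m
  proof -
    have dec: "0 \<le> \<Phi> m - \<Phi> (m + L)"
      using decseqD[OF \<Phi>_dec, of m "m + L"] by simp
    have "\<Phi> (m + L) \<le> C * (window_incr m)\<^sup>2"
      using C[OF that] by (simp add: \<Phi>_def)
    also have "\<dots> \<le> \<bar>C\<bar> * (window_incr m)\<^sup>2"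
      by (intro mult_right_mono) auto
    also have "\<dots> \<le> \<bar>C\<bar> * (D * (\<Phi> m - \<Phi> (m + L)))"
      using D(2)[of m] by (intro mult_left_mono) (auto simp: \<Phi>_def)
    also have "\<dots> \<le> q * (\<Phi> m - \<Phi> (m + L))"
      using dec unfolding q_def mult.assoc[symmetric] by (intro mult_right_mono) auto
    finally show ?thesis
      using q by (simp add: field_simps)
  qed
  then have "\<exists>c \<rho>. 0 < \<rho> \<and> \<rho> < 1 \<and> 0 \<le> c \<and> (\<forall>m. \<Phi> m \<le> c * \<rho> ^ m)"
    by (rule root_linear_decay[OF _ \<Phi>_dec L_pos]) (use q F_inf_le in \<open>auto simp: \<Phi>_def\<close>)
  then show ?thesis
    by (simp add: \<Phi>_def)
qed

text \<open>Squared step lengths are dominated by the gap, so step lengths decay like the square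
  root of its rate and are summable. This makes \<open>y\<close> converge although \<open>F\<close>
  does not control it.\<close>

theorem linear_convergence_to_kkt:
  "\<exists>w C \<rho>. 0 < \<rho> \<and> \<rho> < 1 \<and> (\<forall>c\<in>J. \<forall>m. \<bar>x m c - w c\<bar> \<le> C * \<rho> ^ m) \<and> (\<forall>c\<in>J. kkt w c 0)
     \<and> (\<forall>c\<in>J. c \<in> Q \<longrightarrow> w c \<le> 0)"
proof -
  obtain C \<rho> where \<rho>: "0 < \<rho>" "\<rho> < 1" "C \<ge> 0" and C: "\<And>m. F (x m) - F_inf \<le> C * \<rho> ^ m"
    using F_gap_decay by blast
  obtain \<kappa> where \<kappa>: "\<kappa> > 0" "\<And>m. \<kappa> * (total_incr m)\<^sup>2 \<le> F (x m) - F (x (Suc m))"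
    using sufficient_decrease by blast
  define \<sigma> where "\<sigma> = sqrt \<rho>"
  have \<sigma>: "0 < \<sigma>" "\<sigma> < 1"
    using \<rho> by (auto simp: \<sigma>_def)
  have incr: "\<bar>x (Suc m) c - x m c\<bar> \<le> sqrt (C / \<kappa>) * \<sigma> ^ m" if c: "c \<in> J" for c m
  proof -
    have "\<bar>incr m c\<bar> \<le> total_incr m"
      unfolding total_incr_def using c fin_J by (intro member_le_sum) auto
    also have "\<dots> = sqrt ((total_incr m)\<^sup>2)"
      by (simp add: total_incr_nonneg)
    also have "\<dots> \<le> sqrt (C / \<kappa> * \<rho> ^ m)"
    proof (rule real_sqrt_le_mono)
      have "\<kappa> * (total_incr m)\<^sup>2 \<le> C * \<rho> ^ m"
        using \<kappa>(2)[of m] C[of m] F_inf_le[of "Suc m"] by linarith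
      then show "(total_incr m)\<^sup>2 \<le> C / \<kappa> * \<rho> ^ m"
        using \<kappa>(1) by (simp add: field_simps)
    qed
    also have "\<dots> = sqrt (C / \<kappa>) * \<sigma> ^ m"
      by (simp only: \<sigma>_def real_sqrt_mult real_sqrt_power)
    finally show ?thesis
      by (simp add: incr_def)
  qed
  have "\<forall>c\<in>J. \<exists>l. \<forall>m. \<bar>x m c - l\<bar> \<le> sqrt (C / \<kappa>) / (1 - \<sigma>) * \<sigma> ^ m"
    by (intro ballI geometric_increments_converge incr \<sigma>)
  then obtain w where w: "\<And>c m. c \<in> J \<Longrightarrow> \<bar>x m c - w c\<bar> \<le> sqrt (C / \<kappa>) / (1 - \<sigma>) * \<sigma> ^ m"
    by metis
  have lim: "(\<lambda>m. x m c) \<longlonglongrightarrow> w c" if "c \<in> J" for c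
  proof -
    have "(\<lambda>m. sqrt (C / \<kappa>) / (1 - \<sigma>) * \<sigma> ^ m) \<longlonglongrightarrow> 0"
      using \<sigma> by (intro tendsto_mult_right_zero LIMSEQ_power_zero) auto
    then have "(\<lambda>m. x m c - w c) \<longlonglongrightarrow> 0"
      by (rule Lim_null_comparison[rotated]) (use w[OF that] in simp)
    then show ?thesis
      by (simp add: LIM_zero_cancel)
  qed
  obtain \<Lambda> where \<Lambda>: "\<Lambda> \<ge> 0" "\<And>m c. c \<in> J \<Longrightarrow> kkt (x (m + L)) c (\<Lambda> * window_incr m)"
    using kkt_after_window by blast
  have \<Lambda>W: "(\<lambda>m. \<Lambda> * window_incr m) \<longlonglongrightarrow> 0"
    by (intro tendsto_mult_right_zero window_incr_tendsto)
  have grad_lim: "(\<lambda>m. grad (x (m + L)) c) \<longlonglongrightarrow> grad w c" for c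
    by (rule grad_tendsto) (rule LIMSEQ_ignore_initial_segment[OF lim])
  have "kkt w c 0" if c: "c \<in> J" for c
  proof -
    \<comment> \<open>The multipliers inherit the limit of the gradients because the KKT error tends
      to 0; sign and complementarity then pass to the limit.\<close>
    obtain g where g: "\<And>m. c \<notin> Q \<Longrightarrow> g m = 0" "\<And>m. c \<in> Q \<Longrightarrow> g m \<le> 0" "\<And>m. c \<in> Q \<Longrightarrow> g m * x (m + L) c = 0"
        "\<And>m. \<bar>grad (x (m + L)) c - g m\<bar> \<le> \<Lambda> * window_incr m"
      using \<Lambda>(2)[OF c] unfolding kkt_def by metis
    have "(\<lambda>m. grad (x (m + L)) c - g m) \<longlonglongrightarrow> 0"
      by (rule Lim_null_comparison[OF _ \<Lambda>W]) (simp add: g(4))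
    from tendsto_diff[OF grad_lim[of c] this] have glim: "g \<longlonglongrightarrow> grad w c"
      by simp
    have "grad w c = 0" if "c \<notin> Q"
    proof -
      have "g = (\<lambda>_. 0)"
        using g(1)[OF that] by (rule ext)
      then show ?thesis
        using glim by (simp add: LIMSEQ_const_iff)
    qed
    moreover have "grad w c \<le> 0" if "c \<in> Q"
      using glim by (rule LIMSEQ_le_const2) (use g(2)[OF that] in auto)
    moreover have "grad w c * w c = 0" if "c \<in> Q"
    proof -
      have "(\<lambda>m. g m * x (m + L) c) \<longlonglongrightarrow> grad w c * w c"
        by (intro tendsto_mult glim LIMSEQ_ignore_initial_segment[OF lim[OF c]])
      then show ?thesis
        using g(3)[OF that] by (simp add: LIMSEQ_const_iff)
    qed
    ultimately show ?thesis
      unfolding kkt_def by (intro exI[of _ "grad w c"]) auto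
  qed
  moreover have "w c \<le> 0" if "c \<in> J" "c \<in> Q" for c
    using lim[OF that(1)] by (rule LIMSEQ_le_const2) (use nonpos[OF that] in auto)
  ultimately show ?thesis
    using w \<sigma> by blast
qed

end

subsection \<open>Transport problems\<close>

type_synonym coordinate = "block \<times> nat \<times> nat"

text \<open>A node block has one-dimensional indices, padded by \<open>0\<close> to match those of edge blocks.\<close>

fun block_index :: "block \<Rightarrow> tuple \<Rightarrow> nat \<times> nat" where
  "block_index (Node t) i = (i t, 0)"
| "block_index (Edge e) i = (i (fst e), i (snd e))"

fun index_box :: "mot_problem \<Rightarrow> block \<Rightarrow> (nat \<times> nat) set" where
  "index_box P (Node t) = {1..dims P t} \<times> {0}"
| "index_box P (Edge e) = {1..dims P (fst e)} \<times> {1..dims P (snd e)}"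

fun entry :: "scaling \<Rightarrow> coordinate \<Rightarrow> real" where
  "entry (u, U) (Node t, j, _) = u t j"
| "entry (u, U) (Edge e, j, k) = U e j k"

fun target :: "mot_problem \<Rightarrow> coordinate \<Rightarrow> real" where
  "target P (Node t, j, _) = (if t \<in> eq_modes P then eq_marg P t j else le_marg P t j)"
| "target P (Edge e, j, k) = edge_marg P e j k"

definition le_coords :: "mot_problem \<Rightarrow> coordinate set" where
  "le_coords P = {c. fst c \<in> Node ` le_modes P}"

text \<open>The entries that are not frozen at 0, each of which has a logarithm as its dual
  variable.\<close>

definition coords :: "mot_problem \<Rightarrow> coordinate set" where
  "coords P = (\<lambda>(\<beta>, i). (\<beta>, block_index \<beta> i)) ` (blocks P \<times> support_tuples P)"

text \<open>The matrix \<open>A\<close>; its transpose takes a tensor on the support to its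
  marginals.\<close>

definition incidence :: "tuple \<Rightarrow> coordinate \<Rightarrow> real" where
  "incidence i c = (if block_index (fst c) i = snd c then 1 else 0)"

definition coord_marginal :: "mot_problem \<Rightarrow> tensor \<Rightarrow> coordinate \<Rightarrow> real" where
  "coord_marginal P M c = (\<Sum>i\<in>{i \<in> tuples P. block_index (fst c) i = snd c}. M i)"

lemma incidence_mult: "incidence i c * r = (if block_index (fst c) i = snd c then r else 0)"
  by (simp add: incidence_def)

lemma coord_marginal_Node [simp]: "coord_marginal P M (Node t, j, 0) = marginal P t M j"
  by (simp add: coord_marginal_def marginal_def)

lemma coord_marginal_Edge [simp]: "coord_marginal P M (Edge e, j, k) = bimarginal P e M j k"
  by (simp add: coord_marginal_def bimarginal_def)

text \<open>For positive \<open>m\<close> the expression is \<open>m\<close> times s - 1 - ln s at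
  \<open>s = q / m\<close>, which is nonnegative and vanishes only at 1. It is a summand of the
  generalised Kullback-Leibler divergence.\<close>

lemma pointwise_gibbs:
  fixes m q :: real
  assumes "m \<ge> 0" "q > 0"
  shows "m * (ln m - ln q) - m + q \<ge> 0"
    and "m * (ln m - ln q) - m + q \<le> 0 \<Longrightarrow> m = q"
proof -
  let ?g = "m * (ln m - ln q) - m + q"
  have *: "?g \<ge> 0 \<and> (?g \<le> 0 \<longrightarrow> m = q)"
  proof (cases "m = 0")
    case True
    then show ?thesis using assms by simp
  next
    case False
    then have m: "m > 0" using assms by simp
    then have eq: "?g = m * (q / m - 1 - ln (q / m))"
      using assms by (simp add: ln_div field_simps)
    have "ln (q / m) \<le> q / m - 1"
      using m assms by (intro ln_le_minus_one) auto
    then have ge: "0 \<le> q / m - 1 - ln (q / m)"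
      by simp
    have "m = q" if "?g \<le> 0"
    proof -
      have "q / m - 1 - ln (q / m) \<le> 0"
        using that m unfolding eq by (simp add: mult_le_0_iff)
      then have "ln (q / m) = q / m - 1"
        using ge by simp
      then have "q / m = 1"
        using m assms by (intro ln_eq_minus_one) auto
      then show ?thesis using m by simp
    qed
    then show ?thesis
      using ge m unfolding eq by simp
  qed
  then show "?g \<ge> 0" by blast
  show "m = q" if "?g \<le> 0" using * that by blast
qed

text \<open>Lets the analysis start after the first cycle: the finitely many skipped terms are
  absorbed into the constant.\<close>

lemma shifted_geometric_bound:
  fixes f :: "nat \<Rightarrow> real"
  assumes "0 < \<rho>" and "\<And>m. f (m + n) \<le> C * \<rho> ^ m"
  shows "\<exists>c. \<forall>m. f m \<le> c * \<rho> ^ m"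
proof -
  define c where "c = \<bar>C\<bar> / \<rho> ^ n + (\<Sum>m<n. \<bar>f m\<bar> / \<rho> ^ m)"
  have nonneg: "0 \<le> (\<Sum>m<n. \<bar>f m\<bar> / \<rho> ^ m)" "0 \<le> \<bar>C\<bar> / \<rho> ^ n"
    using assms(1) by (auto intro!: sum_nonneg)
  have "f m \<le> c * \<rho> ^ m" for m
  proof (cases "m < n")
    case True
    have "\<bar>f m\<bar> / \<rho> ^ m \<le> (\<Sum>m<n. \<bar>f m\<bar> / \<rho> ^ m)"
      using True assms(1) by (intro member_le_sum) auto
    then have "\<bar>f m\<bar> / \<rho> ^ m \<le> c"
      using nonneg by (simp add: c_def)
    then show ?thesis
      using assms(1) by (simp add: field_simps)
  next
    case False
    have "f m \<le> C * \<rho> ^ (m - n)"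
      using assms(2)[of "m - n"] False by simp
    also have "\<dots> \<le> \<bar>C\<bar> * \<rho> ^ (m - n)"
      using assms(1) by (intro mult_right_mono) auto
    also have "\<dots> = \<bar>C\<bar> / \<rho> ^ n * \<rho> ^ m"
      using False assms(1) by (simp add: power_diff)
    also have "\<dots> \<le> c * \<rho> ^ m"
      using nonneg assms(1) by (intro mult_right_mono) (auto simp: c_def)
    finally show ?thesis .
  qed
  then show ?thesis by blast
qed

locale transport_problem =
  fixes P :: mot_problem and M0 :: tensor
  assumes valid: "valid_data P"
    and reg_pos: "0 < reg P"
    and cost_nonneg: "\<forall>i\<in>tuples P. 0 \<le> cost P i"
    and M0_feasible: "feasible P M0"
    and M0_support: "\<forall>i\<in>tuples P. 0 < M0 i \<longleftrightarrow> i \<in> support_tuples P"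
begin

section \<open>Supports and feasible tensors\<close>

lemma finite_tuples: "finite (tuples P)"
  by (simp add: tuples_def finite_PiE)

lemma support_subset: "support_tuples P \<subseteq> tuples P"
  by (auto simp: support_tuples_def)

lemma finite_support: "finite (support_tuples P)"
  using finite_tuples support_subset by (rule rev_finite_subset)

lemma mode_subsets:
  "eq_modes P \<subseteq> {1..modes P}" "le_modes P \<subseteq> {1..modes P}"
  "edges P \<subseteq> {1..modes P} \<times> {1..modes P}"
  using valid by (simp_all add: valid_data_def)

lemma finite_modes: "finite (eq_modes P)" "finite (le_modes P)" "finite (edges P)"
  by (rule finite_subset[OF mode_subsets(1)] finite_subset[OF mode_subsets(2)]
      finite_subset[OF mode_subsets(3)]; simp)+

lemma finite_blocks: "finite (blocks P)"
  using finite_modes by (simp add: blocks_def)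

lemma finite_coords: "finite (coords P)"
  using finite_blocks finite_support by (simp add: coords_def)

lemma disjoint_modes: "t \<in> le_modes P \<Longrightarrow> t \<notin> eq_modes P"
  using valid by (auto simp: valid_data_def)

lemma disjoint_modes': "t \<in> eq_modes P \<Longrightarrow> t \<notin> le_modes P"
  using disjoint_modes by blast

lemma block_modes:
  "t \<in> eq_modes P \<Longrightarrow> t \<in> {1..modes P}" "t \<in> le_modes P \<Longrightarrow> t \<in> {1..modes P}"
  "e \<in> edges P \<Longrightarrow> fst e \<in> {1..modes P}" "e \<in> edges P \<Longrightarrow> snd e \<in> {1..modes P}"
proof -
  show "t \<in> eq_modes P \<Longrightarrow> t \<in> {1..modes P}" "t \<in> le_modes P \<Longrightarrow> t \<in> {1..modes P}"
    using mode_subsets(1,2) by blast+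
  show "fst e \<in> {1..modes P}" "snd e \<in> {1..modes P}" if "e \<in> edges P"
    using subsetD[OF mode_subsets(3) that] unfolding mem_Times_iff by blast+
qed

lemma ball_blocks:
  "(\<forall>\<beta>\<in>blocks P. R \<beta>) \<longleftrightarrow>
     (\<forall>t\<in>eq_modes P. R (Node t)) \<and> (\<forall>t\<in>le_modes P. R (Node t)) \<and> (\<forall>e\<in>edges P. R (Edge e))"
  unfolding blocks_def by blast

lemma block_index_in_box:
  assumes "\<beta> \<in> blocks P" "i \<in> tuples P"
  shows "block_index \<beta> i \<in> index_box P \<beta>"
proof -
  have i: "i t \<in> {1..dims P t}" if "t \<in> {1..modes P}" for t
    using assms(2) that unfolding tuples_def by (rule PiE_mem)
  have "\<forall>\<beta>\<in>blocks P. block_index \<beta> i \<in> index_box P \<beta>"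
    unfolding ball_blocks using block_modes i by simp
  then show ?thesis
    using assms(1) by blast
qed

lemma coordsI: "\<beta> \<in> blocks P \<Longrightarrow> i \<in> support_tuples P \<Longrightarrow> (\<beta>, block_index \<beta> i) \<in> coords P"
  by (force simp: coords_def)

lemma coords_in_box: "(\<beta>, k) \<in> coords P \<Longrightarrow> \<beta> \<in> blocks P \<and> k \<in> index_box P \<beta>"
  using block_index_in_box support_subset by (auto simp: coords_def)

lemma target_nonneg:
  assumes "\<beta> \<in> blocks P" "k \<in> index_box P \<beta>"
  shows "0 \<le> target P (\<beta>, k)"
proof -
  have "\<forall>\<beta>\<in>blocks P. \<forall>k\<in>index_box P \<beta>. 0 \<le> target P (\<beta>, k)"
    unfolding ball_blocks using valid disjoint_modes
    by (auto simp: valid_data_def case_prod_beta)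
  then show ?thesis
    using assms by blast
qed

lemma support_tuples_iff:
  assumes "i \<in> tuples P"
  shows "i \<in> support_tuples P \<longleftrightarrow> cost P i < \<infinity> \<and> (\<forall>\<beta>\<in>blocks P. 0 < target P (\<beta>, block_index \<beta> i))"
  using assms unfolding support_tuples_def ball_blocks
  by (simp add: disjoint_modes case_prod_beta)

lemma feasible_iff:
  "feasible P M \<longleftrightarrow> (\<forall>i\<in>tuples P. 0 \<le> M i) \<and>
     (\<forall>\<beta>\<in>blocks P. \<forall>k\<in>index_box P \<beta>.
        if (\<beta>, k) \<in> le_coords P then coord_marginal P M (\<beta>, k) \<le> target P (\<beta>, k)
        else coord_marginal P M (\<beta>, k) = target P (\<beta>, k))"
proof -
  have pairs: "(\<forall>k\<in>A \<times> B. R k) \<longleftrightarrow> (\<forall>a\<in>A. \<forall>b\<in>B. R (a, b))" for A B :: "nat set" and R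
    by blast
  have le: "(Node t, k) \<in> le_coords P \<longleftrightarrow> t \<in> le_modes P" "(Edge e, k) \<in> le_coords P \<longleftrightarrow> False" for t e k
    by (auto simp: le_coords_def)
  show ?thesis
    unfolding feasible_def ball_blocks index_box.simps pairs le case_prod_beta prod.collapse
    by (simp add: disjoint_modes disjoint_modes')
qed

lemma feasible_coord_marginal:
  assumes "feasible P M" "\<beta> \<in> blocks P" "k \<in> index_box P \<beta>"
  shows "coord_marginal P M (\<beta>, k) \<le> target P (\<beta>, k)"
    and "(\<beta>, k) \<notin> le_coords P \<Longrightarrow> coord_marginal P M (\<beta>, k) = target P (\<beta>, k)"
  using assms unfolding feasible_iff by (metis order_refl)+

lemma target_pos:
  assumes "(\<beta>, k) \<in> coords P"
  shows "0 < target P (\<beta>, k)"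
  using assms support_tuples_iff support_subset by (auto simp: coords_def)

text \<open>Serves twice: the zero target makes every feasible tensor vanish at \<open>i\<close>,
  and the entry frozen at 0 makes K \<odot> U vanish there.\<close>

lemma outside_support_zero_target:
  assumes "i \<in> tuples P" "i \<notin> support_tuples P" "cost P i < \<infinity>"
  shows "\<exists>\<beta>\<in>blocks P. (\<beta>, block_index \<beta> i) \<notin> coords P \<and> target P (\<beta>, block_index \<beta> i) = 0"
proof -
  obtain \<beta> where \<beta>: "\<beta> \<in> blocks P" "\<not> 0 < target P (\<beta>, block_index \<beta> i)"
    using assms support_tuples_iff by blast
  then have "(\<beta>, block_index \<beta> i) \<notin> coords P"
    using target_pos by blast
  moreover have "target P (\<beta>, block_index \<beta> i) = 0"
    using \<beta> target_nonneg[OF \<beta>(1) block_index_in_box[OF \<beta>(1) assms(1)]] by simp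
  ultimately show ?thesis
    using \<beta>(1) by blast
qed

lemma feasible_zero:
  assumes "feasible P M" "i \<in> tuples P" "i \<notin> support_tuples P" "cost P i < \<infinity>"
  shows "M i = 0"
proof -
  obtain \<beta> where \<beta>: "\<beta> \<in> blocks P" "target P (\<beta>, block_index \<beta> i) = 0"
    using outside_support_zero_target assms by blast
  have nonneg: "0 \<le> M j" if "j \<in> tuples P" for j
    using assms(1) that by (simp add: feasible_def)
  have "M i \<le> coord_marginal P M (\<beta>, block_index \<beta> i)"
    unfolding coord_marginal_def
    using assms(2) nonneg finite_tuples by (intro member_le_sum) auto
  then show ?thesis
    using feasible_coord_marginal(1)[OF assms(1) \<beta>(1) block_index_in_box[OF \<beta>(1) assms(2)]] \<beta>(2)
      nonneg[OF assms(2)] by simp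
qed

lemma coord_marginal_supported:
  assumes "\<And>i. i \<in> tuples P \<Longrightarrow> i \<notin> support_tuples P \<Longrightarrow> M i = 0"
  shows "coord_marginal P M c = (\<Sum>i\<in>support_tuples P. incidence i c * M i)"
proof -
  have "(\<Sum>i\<in>support_tuples P. incidence i c * M i) = (\<Sum>i\<in>{i \<in> support_tuples P. block_index (fst c) i = snd c}. M i)"
    using finite_support by (simp add: incidence_mult sum.inter_filter)
  also have "\<dots> = coord_marginal P M c"
    unfolding coord_marginal_def
    by (rule sum.mono_neutral_left) (use assms finite_tuples support_subset in auto)
  finally show ?thesis ..
qed

section \<open>Scalings in logarithmic form\<close>

lemma scaling_tensor_eq:
  "scaling_tensor P x i = (\<Prod>\<beta>\<in>blocks P. entry x (\<beta>, block_index \<beta> i))"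
proof (cases x)
  case (Pair u U)
  have "(\<Prod>\<beta>\<in>blocks P. entry x (\<beta>, block_index \<beta> i)) =
      (\<Prod>\<beta>\<in>Node ` (eq_modes P \<union> le_modes P). entry x (\<beta>, block_index \<beta> i)) *
      (\<Prod>\<beta>\<in>Edge ` edges P. entry x (\<beta>, block_index \<beta> i))"
    unfolding blocks_def using finite_modes by (intro prod.union_disjoint) auto
  then show ?thesis
    by (simp add: Pair prod.reindex inj_on_def case_prod_beta)
qed

lemma scaled_kernel_zero:
  assumes "\<And>\<beta> k. \<lbrakk>\<beta> \<in> blocks P; k \<in> index_box P \<beta>; (\<beta>, k) \<notin> coords P\<rbrakk> \<Longrightarrow> entry x (\<beta>, k) = 0"
    and i: "i \<in> tuples P" "i \<notin> support_tuples P"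
  shows "scaled_kernel P x i = 0"
proof (cases "cost P i = \<infinity>")
  case True
  then show ?thesis by (simp add: scaled_kernel_def kernel_def)
next
  case False
  then obtain \<beta> where \<beta>: "\<beta> \<in> blocks P" "(\<beta>, block_index \<beta> i) \<notin> coords P"
    using outside_support_zero_target[OF i] by auto
  then have "entry x (\<beta>, block_index \<beta> i) = 0"
    using assms(1) block_index_in_box i(1) by blast
  then have "(\<Prod>\<beta>\<in>blocks P. entry x (\<beta>, block_index \<beta> i)) = 0"
    using \<beta>(1) finite_blocks by (auto intro: prod_zero)
  then show ?thesis
    by (simp add: scaled_kernel_def scaling_tensor_eq)
qed

lemma kernel_pos: "i \<in> support_tuples P \<Longrightarrow> 0 < kernel P i"
  by (auto simp: support_tuples_def kernel_def)

text \<open>A support tuple meets exactly one coordinate of each block, so \<open>A y\<close> is the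
  logarithm of the product that defines U.\<close>

lemma lin_incidence:
  assumes "i \<in> support_tuples P"
  shows "lin (coords P) incidence y i = (\<Sum>\<beta>\<in>blocks P. y (\<beta>, block_index \<beta> i))"
proof -
  have "lin (coords P) incidence y i = (\<Sum>c\<in>{c \<in> coords P. block_index (fst c) i = snd c}. y c)"
    using finite_coords unfolding lin_def
    by (simp add: incidence_mult sum.inter_filter)
  also have "{c \<in> coords P. block_index (fst c) i = snd c} = (\<lambda>\<beta>. (\<beta>, block_index \<beta> i)) ` blocks P"
    using assms by (auto simp: coords_def image_iff)
  also have "(\<Sum>c\<in>\<dots>. y c) = (\<Sum>\<beta>\<in>blocks P. y (\<beta>, block_index \<beta> i))"
    by (subst sum.reindex) (auto simp: inj_on_def)
  finally show ?thesis .
qed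

lemma scaled_kernel_exp:
  assumes "\<And>c. c \<in> coords P \<Longrightarrow> entry x c = exp (y c)" and i: "i \<in> support_tuples P"
  shows "scaled_kernel P x i = kernel P i * exp (lin (coords P) incidence y i)"
proof -
  have "entry x (\<beta>, block_index \<beta> i) = exp (y (\<beta>, block_index \<beta> i))" if "\<beta> \<in> blocks P" for \<beta>
    using assms(1)[OF coordsI[OF that i]] .
  then show ?thesis
    by (simp add: scaled_kernel_def scaling_tensor_eq lin_incidence[OF i] exp_sum[OF finite_blocks])
qed

lemma entry_update:
  assumes "\<beta> \<in> blocks P" "k \<in> index_box P \<gamma>"
  shows "entry (update P \<beta> x) (\<gamma>, k) =
    (if \<gamma> = \<beta> then
       (let v = entry x (\<gamma>, k) * target P (\<gamma>, k) / coord_marginal P (scaled_kernel P x) (\<gamma>, k)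
        in if (\<gamma>, k) \<in> le_coords P then min v 1 else v)
     else entry x (\<gamma>, k))"
proof -
  obtain u U where x: "x = (u, U)" by (cases x)
  show ?thesis
    using assms disjoint_modes
    by (cases \<beta>; cases \<gamma>) (auto simp: x le_coords_def blocks_def Let_def)
qed

lemma scaling_dist_eq:
  "scaling_dist P x y = (\<Sum>\<beta>\<in>blocks P. \<Sum>k\<in>index_box P \<beta>. \<bar>entry x (\<beta>, k) - entry y (\<beta>, k)\<bar>)"
proof -
  obtain u U v V where xy: "x = (u, U)" "y = (v, V)" by (cases x, cases y)
  have "(\<Sum>\<beta>\<in>blocks P. \<Sum>k\<in>index_box P \<beta>. \<bar>entry x (\<beta>, k) - entry y (\<beta>, k)\<bar>) =
     (\<Sum>\<beta>\<in>Node ` (eq_modes P \<union> le_modes P). \<Sum>k\<in>index_box P \<beta>. \<bar>entry x (\<beta>, k) - entry y (\<beta>, k)\<bar>) +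
     (\<Sum>\<beta>\<in>Edge ` edges P. \<Sum>k\<in>index_box P \<beta>. \<bar>entry x (\<beta>, k) - entry y (\<beta>, k)\<bar>)"
    unfolding blocks_def using finite_modes by (intro sum.union_disjoint) auto
  then show ?thesis
    by (simp add: xy sum.reindex inj_on_def case_prod_beta sum.cartesian_product')
qed

text \<open>The invariant of the scheme. It makes the logarithms of the entries in
  \<open>coords\<close> meaningful and the denominators there positive.\<close>

definition supported :: "scaling \<Rightarrow> bool" where
  "supported x \<longleftrightarrow> (\<forall>\<beta>\<in>blocks P. \<forall>k\<in>index_box P \<beta>.
     if (\<beta>, k) \<in> coords P then 0 < entry x (\<beta>, k) else entry x (\<beta>, k) = 0)"

lemma initial_supported:
  assumes "initial_scaling P x"
  shows "supported x"
proof -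
  obtain u U where x: "x = (u, U)" by (cases x)
  have N: "(Node t, j, 0) \<in> coords P \<longleftrightarrow> (\<exists>i\<in>support_tuples P. i t = j)" if "t \<in> eq_modes P \<union> le_modes P" for t j
    using that by (auto simp: coords_def blocks_def image_iff)
  have E: "(Edge e, j, k) \<in> coords P \<longleftrightarrow> (\<exists>i\<in>support_tuples P. i (fst e) = j \<and> i (snd e) = k)" if "e \<in> edges P" for e j k
    using that by (auto simp: coords_def blocks_def image_iff)
  show ?thesis
    unfolding supported_def
  proof (intro ballI)
    fix \<beta> k assume "\<beta> \<in> blocks P" "k \<in> index_box P \<beta>"
    then show "if (\<beta>, k) \<in> coords P then 0 < entry x (\<beta>, k) else entry x (\<beta>, k) = 0"
    proof (cases \<beta>)
      case (Node t)
      then obtain j where "k = (j, 0)" "j \<in> {1..dims P t}" "t \<in> eq_modes P \<union> le_modes P"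
        using \<open>\<beta> \<in> blocks P\<close> \<open>k \<in> index_box P \<beta>\<close> by (auto simp: blocks_def)
      then show ?thesis
        using assms N[of t j] by (simp add: Node x)
    next
      case (Edge e)
      then obtain j l where "k = (j, l)" "j \<in> {1..dims P (fst e)}" "l \<in> {1..dims P (snd e)}" "e \<in> edges P"
        using \<open>\<beta> \<in> blocks P\<close> \<open>k \<in> index_box P \<beta>\<close> by (auto simp: blocks_def)
      then show ?thesis
        using assms E[of e j l] unfolding Edge x initial_scaling.simps case_prod_beta prod.collapse by simp
    qed
  qed
qed

lemma supported_zero:
  assumes "supported x" "i \<in> tuples P" "i \<notin> support_tuples P"
  shows "scaled_kernel P x i = 0"
  by (rule scaled_kernel_zero[OF _ assms(2,3)]) (use assms(1) in \<open>auto simp: supported_def\<close>)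

lemma supported_exp:
  assumes "supported x" "i \<in> support_tuples P"
  shows "scaled_kernel P x i = kernel P i * exp (lin (coords P) incidence (\<lambda>c. ln (entry x c)) i)"
proof (rule scaled_kernel_exp[OF _ assms(2)])
  fix c assume "c \<in> coords P"
  then show "entry x c = exp (ln (entry x c))"
    using assms(1) coords_in_box[of "fst c" "snd c"] unfolding supported_def
    by (metis exp_ln prod.collapse)
qed

lemma supported_coord_marginal:
  assumes "supported x"
  shows "coord_marginal P (scaled_kernel P x) c =
    (\<Sum>i\<in>support_tuples P. incidence i c * (kernel P i * exp (lin (coords P) incidence (\<lambda>c. ln (entry x c)) i)))"
proof -
  have "coord_marginal P (scaled_kernel P x) c = (\<Sum>i\<in>support_tuples P. incidence i c * scaled_kernel P x i)"
    by (rule coord_marginal_supported) (rule supported_zero[OF assms])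
  then show ?thesis
    by (simp add: supported_exp[OF assms])
qed

lemma supported_coord_marginal_pos:
  assumes "supported x" "c \<in> coords P"
  shows "0 < coord_marginal P (scaled_kernel P x) c"
proof -
  obtain i where i: "i \<in> support_tuples P" "incidence i c = 1"
    using assms(2) by (auto simp: coords_def incidence_def)
  show ?thesis
    unfolding supported_coord_marginal[OF assms(1)]
    by (rule sum_pos2[OF finite_support i(1)])
      (use i kernel_pos in \<open>auto simp: incidence_def less_imp_le\<close>)
qed

lemma supported_update:
  assumes "supported x" "\<gamma> \<in> blocks P"
  shows "supported (update P \<gamma> x)"
  unfolding supported_def
proof (intro ballI)
  fix \<beta> k assume \<beta>: "\<beta> \<in> blocks P" "k \<in> index_box P \<beta>"
  show "if (\<beta>, k) \<in> coords P then 0 < entry (update P \<gamma> x) (\<beta>, k) else entry (update P \<gamma> x) (\<beta>, k) = 0"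
  proof (cases "(\<beta>, k) \<in> coords P")
    case True
    then have pos: "0 < entry x (\<beta>, k)"
      using assms(1) \<beta> by (auto simp: supported_def)
    then have "0 < entry x (\<beta>, k) * target P (\<beta>, k) / coord_marginal P (scaled_kernel P x) (\<beta>, k)"
      using target_pos[OF True] supported_coord_marginal_pos[OF assms(1) True]
      by (intro divide_pos_pos mult_pos_pos)
    then show ?thesis
      using True pos by (auto simp: entry_update[OF assms(2) \<beta>(2)] Let_def)
  next
    case False
    then have "entry x (\<beta>, k) = 0"
      using assms(1) \<beta> by (auto simp: supported_def)
    then show ?thesis
      using False by (auto simp: entry_update[OF assms(2) \<beta>(2)] Let_def)
  qed
qed

lemma supported_scheme:
  assumes "supported x" "set bs = blocks P"
  shows "supported (scheme P bs x m)"
proof (induction m)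
  case (Suc m)
  have "bs ! (m mod length bs) \<in> blocks P" if "bs \<noteq> []"
    using that assms(2) by (metis nth_mem length_greater_0_conv mod_less_divisor)
  then show ?case
    using Suc by (auto simp: supported_update)
qed (simp add: assms(1))

section \<open>Primal optimality\<close>

lemma objective_infinite:
  assumes "feasible P M" "i \<in> tuples P" "cost P i = \<infinity>" "M i \<noteq> 0"
  shows "objective P M = \<infinity>"
proof -
  have nonneg: "0 \<le> M j" if "j \<in> tuples P" for j
    using assms(1) that by (simp add: feasible_def)
  have "cost P i * ereal (M i) = \<infinity>"
    using assms(3,4) nonneg[OF assms(2)] by simp
  then have "(\<Sum>i\<in>tuples P. cost P i * ereal (M i)) = \<infinity>"
    using assms(2) finite_tuples by (auto simp: sum_Pinfty)
  then show ?thesis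
    by (simp add: objective_def)
qed

text \<open>On the support the cost is \<open>- reg P * ln (kernel P i)\<close>, so cost and entropy
  merge into a Kullback-Leibler divergence from the kernel, written without its constant
  part.\<close>

definition relative_entropy :: "tensor \<Rightarrow> real" where
  "relative_entropy M = (\<Sum>i\<in>support_tuples P. M i * (ln (M i) - ln (kernel P i)) - M i)"

text \<open>The cardinality collects the summands 1 of the entropy, which tuples with
  \<open>M i = 0\<close> contribute as well.\<close>

lemma objective_supported:
  assumes "\<And>i. i \<in> tuples P \<Longrightarrow> i \<notin> support_tuples P \<Longrightarrow> M i = 0"
  shows "objective P M = ereal (reg P * (relative_entropy M + real (card (tuples P))))"
proof -
  have cost: "cost P i = ereal (- reg P * ln (kernel P i))" if "i \<in> support_tuples P" for i
  proof -
    have "cost P i \<noteq> \<infinity>" "0 \<le> cost P i"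
      using that cost_nonneg by (auto simp: support_tuples_def)
    then obtain r where "cost P i = ereal r"
      by (cases "cost P i") auto
    then show ?thesis
      using reg_pos by (simp add: kernel_def)
  qed
  have "(\<Sum>i\<in>tuples P. cost P i * ereal (M i)) = (\<Sum>i\<in>support_tuples P. cost P i * ereal (M i))"
    by (rule sum.mono_neutral_right) (use finite_tuples support_subset assms in auto)
  also have "\<dots> = ereal (\<Sum>i\<in>support_tuples P. - reg P * ln (kernel P i) * M i)"
    by (simp add: cost)
  finally have 1: "(\<Sum>i\<in>tuples P. cost P i * ereal (M i)) = ereal (\<Sum>i\<in>support_tuples P. - reg P * ln (kernel P i) * M i)" .
  have "entropy_term P M = (\<Sum>i\<in>tuples P. M i * ln (M i) - M i) + real (card (tuples P))"
    by (simp add: entropy_term_def sum.distrib)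
  also have "(\<Sum>i\<in>tuples P. M i * ln (M i) - M i) = (\<Sum>i\<in>support_tuples P. M i * ln (M i) - M i)"
    by (rule sum.mono_neutral_right) (use finite_tuples support_subset assms in auto)
  finally have 2: "entropy_term P M = (\<Sum>i\<in>support_tuples P. M i * ln (M i) - M i) + real (card (tuples P))" .
  have "(\<Sum>i\<in>support_tuples P. - reg P * ln (kernel P i) * M i) + reg P * entropy_term P M
      = reg P * (relative_entropy M + real (card (tuples P)))"
    unfolding 2 relative_entropy_def
    by (simp add: sum_distrib_left algebra_simps sum_subtractf sum_negf sum.distrib)
  then show ?thesis
    unfolding objective_def 1 by simp
qed

text \<open>With \<open>z = A w\<close>, the logarithm of U, \<open>relative_entropy M\<close> is
  the sum of \<open>M i * z i - K i + gap M i\<close>, and adjointness turns the pairing with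
  \<open>z\<close> into marginals paired with \<open>w\<close>. Since \<open>w\<close> is
  nonpositive on inequality coordinates, complementarity makes this pairing smallest at
  \<open>K\<close>. So \<open>M\<close> is worse than \<open>K\<close> by at least the total gap,
  which gives optimality and, because a gap vanishes only for equal entries, uniqueness.\<close>

lemma kkt_scaling_optimal:
  assumes entry: "\<And>c. c \<in> coords P \<Longrightarrow> entry x c = exp (w c)"
    and zero: "\<And>\<beta> k. \<lbrakk>\<beta> \<in> blocks P; k \<in> index_box P \<beta>; (\<beta>, k) \<notin> coords P\<rbrakk> \<Longrightarrow> entry x (\<beta>, k) = 0"
    and nonpos: "\<And>c. c \<in> coords P \<Longrightarrow> c \<in> le_coords P \<Longrightarrow> w c \<le> 0"
    and eq: "\<And>c. c \<in> coords P \<Longrightarrow> c \<notin> le_coords P \<Longrightarrow> coord_marginal P (scaled_kernel P x) c = target P c"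
    and le: "\<And>c. c \<in> coords P \<Longrightarrow> c \<in> le_coords P \<Longrightarrow> coord_marginal P (scaled_kernel P x) c \<le> target P c"
    and compl: "\<And>c. c \<in> coords P \<Longrightarrow> c \<in> le_coords P \<Longrightarrow>
        (coord_marginal P (scaled_kernel P x) c - target P c) * w c = 0"
  shows "optimal P (scaled_kernel P x) \<and>
    (\<forall>M. optimal P M \<longrightarrow> (\<forall>i\<in>tuples P. M i = scaled_kernel P x i))"
proof -
  let ?S = "support_tuples P"
  define K where "K = scaled_kernel P x"
  define z where "z = lin (coords P) incidence w"
  have K_zero: "K i = 0" if "i \<in> tuples P" "i \<notin> ?S" for i
    unfolding K_def using zero that by (rule scaled_kernel_zero)
  have K_exp: "K i = kernel P i * exp (z i)" if "i \<in> ?S" for i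
    unfolding K_def z_def using entry that by (rule scaled_kernel_exp)
  have K_pos: "0 < K i" if "i \<in> ?S" for i
    using K_exp[OF that] kernel_pos[OF that] by simp
  have K_feasible: "feasible P K"
    unfolding feasible_iff
  proof (intro conjI ballI)
    show "0 \<le> K i" if "i \<in> tuples P" for i
      using K_zero[OF that] K_pos[of i] by (cases "i \<in> ?S") auto
    fix \<beta> k assume \<beta>: "\<beta> \<in> blocks P" "k \<in> index_box P \<beta>"
    show "if (\<beta>, k) \<in> le_coords P then coord_marginal P K (\<beta>, k) \<le> target P (\<beta>, k)
        else coord_marginal P K (\<beta>, k) = target P (\<beta>, k)"
    proof (cases "(\<beta>, k) \<in> coords P")
      case True
      then show ?thesis
        using eq le by (simp add: K_def)
    next
      case False
      \<comment> \<open>No support tuple projects to this entry, so \<open>K\<close> and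
        \<open>M0\<close> both have marginal 0 there; an equality target must then be 0 because
        \<open>M0\<close> is feasible.\<close>
      have off: "i \<notin> ?S" if "block_index \<beta> i = k" for i
        using False \<beta>(1) that by (auto simp: coords_def)
      have M0_zero: "M0 i = 0" if "i \<in> tuples P" "i \<notin> ?S" for i
        using M0_support M0_feasible that unfolding feasible_def by fastforce
      have "coord_marginal P K (\<beta>, k) = 0" "coord_marginal P M0 (\<beta>, k) = 0"
        unfolding coord_marginal_def by (intro sum.neutral ballI; use off K_zero M0_zero in auto)+
      then show ?thesis
        using target_nonneg[OF \<beta>] feasible_coord_marginal(2)[OF M0_feasible \<beta>] by simp
    qed
  qed
  have dual: "(\<Sum>i\<in>?S. M i * z i) = (\<Sum>c\<in>coords P. coord_marginal P M c * w c)"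
    if "\<And>i. i \<in> tuples P \<Longrightarrow> i \<notin> ?S \<Longrightarrow> M i = 0" for M
    unfolding z_def sum_lin_swap using coord_marginal_supported[OF that] by simp
  have K_dual: "(\<Sum>i\<in>?S. K i * z i) = (\<Sum>c\<in>coords P. target P c * w c)"
  proof -
    have "(\<Sum>i\<in>?S. K i * z i) = (\<Sum>c\<in>coords P. coord_marginal P K c * w c)"
      by (rule dual) (rule K_zero)
    also have "\<dots> = (\<Sum>c\<in>coords P. target P c * w c)"
    proof (rule sum.cong[OF refl])
      show "coord_marginal P K c * w c = target P c * w c" if "c \<in> coords P" for c
        using eq[OF that] compl[OF that] unfolding K_def by (cases "c \<in> le_coords P") (auto simp: algebra_simps)
    qed
    finally show ?thesis .
  qed
  have K_entropy: "relative_entropy K = (\<Sum>i\<in>?S. K i * z i - K i)"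
    unfolding relative_entropy_def
  proof (rule sum.cong[OF refl])
    show "K i * (ln (K i) - ln (kernel P i)) - K i = K i * z i - K i" if "i \<in> ?S" for i
      using kernel_pos[OF that] by (simp add: K_exp[OF that] ln_mult)
  qed
  define gap where "gap M i = M i * (ln (M i) - ln (K i)) - M i + K i" for M i
  have gap_nonneg: "0 \<le> gap M i" if "feasible P M" "i \<in> ?S" for M i
    unfolding gap_def using that support_subset
    by (intro pointwise_gibbs K_pos) (auto simp: feasible_def)
  have entropy: "relative_entropy K + (\<Sum>i\<in>?S. gap M i) \<le> relative_entropy M"
    if M: "feasible P M" "\<And>i. i \<in> tuples P \<Longrightarrow> i \<notin> ?S \<Longrightarrow> M i = 0" for M
  proof -
    have "(\<Sum>c\<in>coords P. target P c * w c) \<le> (\<Sum>c\<in>coords P. coord_marginal P M c * w c)"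
    proof (rule sum_mono)
      fix c assume c: "c \<in> coords P"
      then have "coord_marginal P M c \<le> target P c" "c \<notin> le_coords P \<Longrightarrow> coord_marginal P M c = target P c"
        using coords_in_box[of "fst c" "snd c"] feasible_coord_marginal[OF M(1), of "fst c" "snd c"] by auto
      then show "target P c * w c \<le> coord_marginal P M c * w c"
        using nonpos[OF c] by (cases "c \<in> le_coords P") (auto intro: mult_right_mono_neg)
    qed
    also have "\<dots> = (\<Sum>i\<in>?S. M i * z i)"
      by (rule dual[symmetric]) (rule M(2))
    finally have "(\<Sum>i\<in>?S. K i * z i) \<le> (\<Sum>i\<in>?S. M i * z i)"
      unfolding K_dual .
    moreover have "relative_entropy M = (\<Sum>i\<in>?S. M i * z i - K i + gap M i)"
      unfolding relative_entropy_def
    proof (rule sum.cong[OF refl])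
      show "M i * (ln (M i) - ln (kernel P i)) - M i = M i * z i - K i + gap M i" if "i \<in> ?S" for i
        using kernel_pos[OF that] by (simp add: gap_def K_exp[OF that] ln_mult algebra_simps)
    qed
    ultimately show ?thesis
      by (simp add: K_entropy sum.distrib sum_subtractf)
  qed
  \<comment> \<open>A tuple off the support has infinite cost, or finite cost and a block whose
    target is 0.\<close>
  have off_support: "M i = 0" if "feasible P M" "objective P M \<noteq> \<infinity>" "i \<in> tuples P" "i \<notin> ?S" for M i
    using that feasible_zero objective_infinite by (cases "cost P i = \<infinity>") auto
  have K_obj: "objective P K = ereal (reg P * (relative_entropy K + real (card (tuples P))))"
    by (rule objective_supported) (rule K_zero)
  have "objective P K \<le> objective P M" if "feasible P M" for M
  proof (cases "objective P M = \<infinity>")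
    case False
    have M: "M i = 0" if "i \<in> tuples P" "i \<notin> ?S" for i
      using off_support[OF \<open>feasible P M\<close> False that] .
    have "0 \<le> (\<Sum>i\<in>?S. gap M i)"
      using gap_nonneg[OF that] by (rule sum_nonneg)
    then have "relative_entropy K \<le> relative_entropy M"
      using entropy[OF that M] by simp
    then show ?thesis
      using reg_pos by (simp add: K_obj objective_supported[OF M])
  qed simp
  then have K_opt: "optimal P K"
    using K_feasible by (simp add: optimal_def)
  have "M i = K i" if "optimal P M" "i \<in> tuples P" for M i
  proof -
    have feas: "feasible P M" and obj: "objective P M \<le> objective P K"
      using that(1) K_feasible by (auto simp: optimal_def)
    from obj have fin: "objective P M \<noteq> \<infinity>"
      by (auto simp: K_obj)
    have M: "M i = 0" if "i \<in> tuples P" "i \<notin> ?S" for i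
      using off_support[OF feas fin that] .
    have "relative_entropy M \<le> relative_entropy K"
      using obj reg_pos by (simp add: K_obj objective_supported[OF M])
    then have "(\<Sum>i\<in>?S. gap M i) \<le> 0"
      using entropy[OF feas M] by simp
    then have "(\<Sum>i\<in>?S. gap M i) = 0"
      using gap_nonneg[OF feas] by (simp add: antisym sum_nonneg)
    then have gap0: "gap M i = 0" if "i \<in> ?S" for i
      using sum_nonneg_eq_0_iff[OF finite_support, of "gap M"] gap_nonneg[OF feas] that by blast
    show "M i = K i"
    proof (cases "i \<in> ?S")
      case True
      then show ?thesis
        using gap0[OF True] pointwise_gibbs(2)[of "M i" "K i"] K_pos[OF True] feas that(2)
        by (simp add: gap_def feasible_def)
    qed (use M K_zero that(2) in simp)
  qed
  with K_opt show ?thesis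
    by (simp add: K_def)
qed

section \<open>The cyclic scheme in logarithmic variables\<close>

lemma entry_step:
  assumes "bs \<noteq> []" "set bs = blocks P" "k \<in> index_box P \<gamma>"
  shows "entry (scheme P bs x (Suc m)) (\<gamma>, k) =
    (if \<gamma> = bs ! (m mod length bs) then
       (let v = entry (scheme P bs x m) (\<gamma>, k) * target P (\<gamma>, k)
                  / coord_marginal P (scaled_kernel P (scheme P bs x m)) (\<gamma>, k)
        in if (\<gamma>, k) \<in> le_coords P then min v 1 else v)
     else entry (scheme P bs x m) (\<gamma>, k))"
proof -
  have "bs ! (m mod length bs) \<in> blocks P"
    using assms(1,2) by (metis nth_mem length_greater_0_conv mod_less_divisor)
  then show ?thesis
    using assms(1) entry_update[OF _ assms(3)] by simp
qed

text \<open>Initial values may exceed 1. The first visit to the block clips them, and only further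
  clipped updates change them afterwards.\<close>

lemma le_entry_after_cycle:
  assumes "bs \<noteq> []" "set bs = blocks P" "k \<in> index_box P (bs ! l)" "l < length bs" "(bs ! l, k) \<in> le_coords P"
    and "l < m"
  shows "entry (scheme P bs x m) (bs ! l, k) \<le> 1"
  using \<open>l < m\<close>
proof (induction m)
  case (Suc m)
  show ?case
  proof (cases "bs ! l = bs ! (m mod length bs)")
    case True
    then show ?thesis
      using assms(5) unfolding entry_step[OF assms(1-3)] by (simp add: Let_def)
  next
    case False
    then have "l \<noteq> m"
      using assms(4) by auto
    then show ?thesis
      using False Suc unfolding entry_step[OF assms(1-3)] by simp
  qed
qed simp

lemma scheme_converges_to_optimum:
  assumes bs: "set bs = blocks P" and x0: "initial_scaling P x0"
  shows "\<exists>x. converges_linearly P (scheme P bs x0) x \<and> optimal P (scaled_kernel P x) \<and>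
    (\<forall>M. optimal P M \<longrightarrow> (\<forall>i\<in>tuples P. M i = scaled_kernel P x i))"
proof -
  let ?S = "support_tuples P"
  define n where "n = length bs"
  \<comment> \<open>The iteration is observed from the end of the first cycle, when all inequality
    entries are at most 1. A shift by a full cycle preserves the position within the cycle.\<close>
  define X where "X m = scheme P bs x0 (m + n)" for m
  define y where "y m c = ln (entry (X m) c)" for m c
  \<comment> \<open>The guard excludes the unspecified element \<open>[] ! m\<close>, since
    \<open>m mod 0 = m\<close>.\<close>
  define B where "B m = {c :: coordinate. bs \<noteq> [] \<and> fst c = bs ! (m mod n)}" for m
  have X_supp: "supported (X m)" for m
    unfolding X_def by (intro supported_scheme initial_supported x0 bs)
  have X_pos: "0 < entry (X m) c" if "c \<in> coords P" for m c
    using X_supp[of m] coords_in_box[of "fst c" "snd c"] that unfolding supported_def by force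
  have coords_bs: "bs \<noteq> [] \<and> (\<exists>l<n. fst c = bs ! l)" if "c \<in> coords P" for c
  proof -
    have "fst c \<in> set bs"
      using coords_in_box[of "fst c" "snd c"] that bs by simp
    then show ?thesis
      by (auto simp: in_set_conv_nth n_def)
  qed
  have coord_marg: "coord_marginal P (scaled_kernel P (X m)) c
      = (\<Sum>i\<in>?S. incidence i c * (kernel P i * exp (lin (coords P) incidence (y m) i)))" for m c
    unfolding y_def by (rule supported_coord_marginal[OF X_supp])
  have M0_zero: "M0 i = 0" if "i \<in> tuples P" "i \<notin> ?S" for i
    using M0_support M0_feasible that unfolding feasible_def by fastforce
  have M0_marginal: "(\<Sum>i\<in>?S. incidence i c * M0 i) = coord_marginal P M0 c" for c
    by (rule coord_marginal_supported[symmetric]) (rule M0_zero)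
  \<comment> \<open>A window of \<open>n\<close> steps visits every block; \<open>Suc n\<close>
    keeps the window length positive when there are no blocks.\<close>
  interpret D: block_dual_ascent ?S "coords P" incidence "kernel P" M0 "target P" "le_coords P" y B "Suc n"
  proof
    show "finite ?S" by (rule finite_support)
    show "finite (coords P)" by (rule finite_coords)
    show "incidence i c = 0 \<or> incidence i c = 1" for i c
      by (simp add: incidence_def)
    show "\<exists>i\<in>?S. incidence i c = 1" if "c \<in> coords P" for c
      using that by (auto simp: coords_def incidence_def)
    show "0 < kernel P i" if "i \<in> ?S" for i
      using that by (rule kernel_pos)
    show "0 < M0 i" if "i \<in> ?S" for i
      using that M0_support support_subset by blast
    show "0 < target P c" if "c \<in> coords P" for c
      using that target_pos[of "fst c" "snd c"] by simp
    show "(\<Sum>i\<in>?S. incidence i c * M0 i) = target P c" if "c \<in> coords P" "c \<notin> le_coords P" for c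
      unfolding M0_marginal
      using that coords_in_box[of "fst c" "snd c"] feasible_coord_marginal(2)[OF M0_feasible, of "fst c" "snd c"]
      by simp
    show "(\<Sum>i\<in>?S. incidence i c * M0 i) \<le> target P c" if "c \<in> coords P" "c \<in> le_coords P" for c
      unfolding M0_marginal
      using that coords_in_box[of "fst c" "snd c"] feasible_coord_marginal(1)[OF M0_feasible, of "fst c" "snd c"]
      by simp
    show "c = d" if "c \<in> B m" "d \<in> B m" "incidence i c = 1" "incidence i d = 1" for i c d m
      using that by (auto simp: B_def incidence_def prod_eq_iff split: if_splits)
    show "y 0 c \<le> 0" if c: "c \<in> coords P" "c \<in> le_coords P" for c
    proof -
      obtain l where l: "bs \<noteq> []" "l < n" "fst c = bs ! l"
        using coords_bs[OF c(1)] by blast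
      obtain k where k: "c = (bs ! l, k)"
        using l(3) by (cases c) simp
      have "entry (scheme P bs x0 n) (bs ! l, k) \<le> 1"
        using coords_in_box c l(2) unfolding k n_def by (intro le_entry_after_cycle l(1) bs) auto
      then have "entry (X 0) c \<le> 1"
        by (simp add: X_def k)
      then show ?thesis
        using X_pos[OF c(1), of 0] by (simp add: y_def)
    qed
    show "y (Suc m) c = (if c \<in> B m then
         (let v = y m c + ln (target P c / (\<Sum>i\<in>?S. incidence i c * (kernel P i * exp (lin (coords P) incidence (y m) i))))
          in if c \<in> le_coords P then min v 0 else v)
       else y m c)" if c: "c \<in> coords P" for m c
    proof -
      have ne: "bs \<noteq> []"
        using coords_bs[OF c] by blast
      have box: "snd c \<in> index_box P (fst c)"
        using coords_in_box[of "fst c" "snd c"] c by simp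
      have "entry (X (Suc m)) c = (if fst c = bs ! (m mod n) then
            (let v = entry (X m) c * target P c / coord_marginal P (scaled_kernel P (X m)) c
             in if c \<in> le_coords P then min v 1 else v) else entry (X m) c)"
        using entry_step[OF ne bs box, of x0 "m + n"]
        unfolding X_def n_def prod.collapse add_Suc mod_add_self2 .
      moreover have pos: "0 < entry (X m) c" "0 < target P c" "0 < coord_marginal P (scaled_kernel P (X m)) c"
        using X_pos[OF c] target_pos[of "fst c" "snd c"] supported_coord_marginal_pos[OF X_supp c] c by auto
      moreover have "ln (min v 1) = min (ln v) 0" if "0 < v" for v :: real
        using that by (auto simp: min_def)
      moreover have "ln (entry (X m) c * target P c / coord_marginal P (scaled_kernel P (X m)) c)
          = y m c + ln (target P c / coord_marginal P (scaled_kernel P (X m)) c)"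
        using pos by (simp add: y_def ln_mult ln_div)
      ultimately show ?thesis
        unfolding coord_marg[symmetric] using ne by (simp add: y_def B_def Let_def)
    qed
    show "\<exists>j<Suc n. c \<in> B (m + j)" if c: "c \<in> coords P" for m c
    proof -
      obtain l where l: "bs \<noteq> []" "l < n" "fst c = bs ! l"
        using coords_bs[OF c] by blast
      \<comment> \<open>The number of steps from the current position \<open>m mod n\<close> to the
        next visit of position \<open>l\<close>.\<close>
      define j where "j = (l + (n - m mod n)) mod n"
      have "m mod n < n"
        using l(2) by simp
      have "(m + j) mod n = (m mod n + (l + (n - m mod n))) mod n"
        unfolding j_def by (simp add: mod_simps)
      also have "m mod n + (l + (n - m mod n)) = l + n"
        using \<open>m mod n < n\<close> by simp
      finally have "(m + j) mod n = l"
        using l(2) by simp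
      moreover have "j < n"
        using l(2) by (simp add: j_def)
      ultimately show ?thesis
        using l by (intro exI[of _ j]) (simp add: B_def)
    qed
    show "0 < Suc n" by simp
  qed
  obtain w C \<rho> where \<rho>: "0 < \<rho>" "\<rho> < 1"
    and rate: "\<And>c m. c \<in> coords P \<Longrightarrow> \<bar>y m c - w c\<bar> \<le> C * \<rho> ^ m"
    and kkt: "\<And>c. c \<in> coords P \<Longrightarrow> D.kkt w c 0"
    and nonpos: "\<And>c. c \<in> coords P \<Longrightarrow> c \<in> le_coords P \<Longrightarrow> w c \<le> 0"
    using D.linear_convergence_to_kkt by blast
  define x :: scaling where
    "x = (\<lambda>t j. if (Node t, j, 0) \<in> coords P then exp (w (Node t, j, 0)) else 0,
          \<lambda>e j k. if (Edge e, j, k) \<in> coords P then exp (w (Edge e, j, k)) else 0)"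
  have x_entry: "entry x (\<beta>, k) = (if (\<beta>, k) \<in> coords P then exp (w (\<beta>, k)) else 0)"
    if "k \<in> index_box P \<beta>" for \<beta> k
    using that by (cases \<beta>) (auto simp: x_def)
  have x_coord: "entry x c = exp (w c)" if "c \<in> coords P" for c
    using x_entry[of "snd c" "fst c"] coords_in_box[of "fst c" "snd c"] that by simp
  have x_zero: "entry x (\<beta>, k) = 0" if "\<beta> \<in> blocks P" "k \<in> index_box P \<beta>" "(\<beta>, k) \<notin> coords P" for \<beta> k
    using x_entry that by simp
  have marg: "coord_marginal P (scaled_kernel P x) c - target P c = D.grad w c" for c
  proof -
    have "coord_marginal P (scaled_kernel P x) c = (\<Sum>i\<in>?S. incidence i c * scaled_kernel P x i)"
      by (rule coord_marginal_supported) (rule scaled_kernel_zero[OF x_zero])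
    also have "\<dots> = D.col w c"
      unfolding D.col_def D.mass_def by (simp add: scaled_kernel_exp[OF x_coord])
    finally show ?thesis
      by (simp add: D.grad_def)
  qed
  have "optimal P (scaled_kernel P x) \<and> (\<forall>M. optimal P M \<longrightarrow> (\<forall>i\<in>tuples P. M i = scaled_kernel P x i))"
  proof (rule kkt_scaling_optimal[OF x_coord x_zero nonpos])
    fix c assume c: "c \<in> coords P"
    show "coord_marginal P (scaled_kernel P x) c = target P c" if "c \<notin> le_coords P"
      using kkt[OF c] that marg[of c] by (auto simp: D.kkt_def)
    show "coord_marginal P (scaled_kernel P x) c \<le> target P c" if "c \<in> le_coords P"
      using kkt[OF c] that marg[of c] by (auto simp: D.kkt_def)
    show "(coord_marginal P (scaled_kernel P x) c - target P c) * w c = 0" if "c \<in> le_coords P"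
      using kkt[OF c] that unfolding marg by (auto simp: D.kkt_def)
  qed
  moreover have "converges_linearly P (scheme P bs x0) x"
  proof -
    \<comment> \<open>The first factor is a Lipschitz constant of exp on the interval around 0 that
      contains \<open>w c\<close> and all \<open>y m c\<close>, since they differ by at most
      \<open>\<bar>C\<bar>\<close>.\<close>
    define E where "E c = exp (\<bar>w c\<bar> + \<bar>C\<bar>) * \<bar>C\<bar>" for c
    have E: "\<bar>entry (X m) (\<beta>, k) - entry x (\<beta>, k)\<bar> \<le> E (\<beta>, k) * \<rho> ^ m"
      if \<beta>: "\<beta> \<in> blocks P" "k \<in> index_box P \<beta>" for \<beta> k m
    proof (cases "(\<beta>, k) \<in> coords P")
      case True
      have "C * \<rho> ^ m \<le> \<bar>C\<bar> * \<rho> ^ m"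
        using \<rho>(1) by (intro mult_right_mono) auto
      then have near: "\<bar>y m (\<beta>, k) - w (\<beta>, k)\<bar> \<le> \<bar>C\<bar> * \<rho> ^ m"
        using rate[OF True, of m] by linarith
      also have "\<dots> \<le> \<bar>C\<bar> * 1"
        using \<rho> by (intro mult_left_mono power_le_one) auto
      finally have "\<bar>exp (y m (\<beta>, k)) - exp (w (\<beta>, k))\<bar>
          \<le> exp (\<bar>w (\<beta>, k)\<bar> + \<bar>C\<bar>) * \<bar>y m (\<beta>, k) - w (\<beta>, k)\<bar>"
        by (intro exp_diff_bounds(1)) auto
      also have "\<dots> \<le> exp (\<bar>w (\<beta>, k)\<bar> + \<bar>C\<bar>) * (\<bar>C\<bar> * \<rho> ^ m)"
        using near by (intro mult_left_mono) auto
      finally show ?thesis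
        using X_pos[OF True, of m] x_coord[OF True] by (simp add: y_def E_def mult.assoc)
    next
      case False
      have "0 \<le> E (\<beta>, k) * \<rho> ^ m"
        using \<rho>(1) by (simp add: E_def)
      then show ?thesis
        using X_supp[of m] x_zero[OF \<beta> False] False \<beta> by (simp add: supported_def)
    qed
    have "scaling_dist P (X m) x \<le> (\<Sum>\<beta>\<in>blocks P. \<Sum>k\<in>index_box P \<beta>. E (\<beta>, k)) * \<rho> ^ m" for m
      unfolding scaling_dist_eq sum_distrib_right by (intro sum_mono E)
    then have "\<exists>c. \<forall>m. scaling_dist P (scheme P bs x0 m) x \<le> c * \<rho> ^ m"
      unfolding X_def by (rule shifted_geometric_bound[OF \<rho>(1)])
    then show ?thesis
      using \<rho> unfolding converges_linearly_def by blast
  qed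
  ultimately show ?thesis by blast
qed

end

theorem proposition1:
  fixes P :: mot_problem and bs :: "block list" and x0 :: scaling
  assumes "valid_data P"
    and "0 < reg P"
    and "\<forall>i\<in>tuples P. 0 \<le> cost P i"
    and "\<exists>M. feasible P M \<and> (\<forall>i\<in>tuples P. 0 < M i \<longleftrightarrow> i \<in> support_tuples P)"
    and "distinct bs" and "set bs = blocks P"
    and "initial_scaling P x0"
  shows "\<exists>x. converges_linearly P (scheme P bs x0) x \<and>
             optimal P (scaled_kernel P x) \<and>
             (\<forall>M. optimal P M \<longrightarrow> (\<forall>i\<in>tuples P. M i = scaled_kernel P x i))"
proof -
  obtain M0 where "feasible P M0" "\<forall>i\<in>tuples P. 0 < M0 i \<longleftrightarrow> i \<in> support_tuples P"
    using assms(4) by blast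
  then interpret transport_problem P M0
    using assms(1-3) by unfold_locales
  show ?thesis
    using assms(6,7) by (rule scheme_converges_to_optimum)
qed

end
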